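(* (i) For every $\mathbf t\in\mathbb R^d$ and $M\ge0$, \begin{align*} &\mathrm P_{\Sigma^{-1/2}\boldsymbol\Delta=\mathbf t}\big((\hat{\boldsymbol\tau}_{\rm PT}-\boldsymbol\tau)^\top(\Sigma_0^{-1}+\Sigma_1^{-1})(\hat{\boldsymbol\tau}_{\rm PT}-\boldsymbol\tau)\le M\big)\\ ={}&\Psi_d\big(M;\|(\Sigma_0^{-1}+\Sigma_1^{-1})^{-1/2}\Sigma_1^{-1}\Sigma^{1/2}\mathbf t\|_2^2\big)\,\Psi_d\big(q;\|(\Sigma_0+\Sigma_1)^{-1/2}\Sigma^{1/2}\mathbf t\|_2^2\big)\\ &+\int_{\|\mathbf u\|_2^2>q}\Psi_d\big(M;\|(\Sigma_0^{-1}+\Sigma_1^{-1})^{-1/2}\Sigma_1^{-1}[\Sigma^{1/2}\mathbf t-(\Sigma_0+\Sigma_1)^{1/2}\mathbf u]\|_2^2\big)\,\phi_{(\Sigma_0+\Sigma_1)^{-1/2}\Sigma^{1/2}\mathbf t,\,I_d}(\mathbf u)\,d\mathbf u. \end{align*} (ii) Let \[ \hat M_{\rm PT}=\inf\Big\{M\ge0:\inf_{\boldsymbol\Delta:|\Sigma^{-1/2}\boldsymbol\Delta|\le\mathbf b}\mathrm P_{\boldsymbol\Delta}\big((\hat{\boldsymbol\tau}_{\rm PT}-\boldsymbol\tau)^\top(\Sigma_0^{-1}+\Sigma_1^{-1})(\hat{\boldsymbol\tau}_{\rm PT}-\boldsymbol\tau)\le M\big)\ge1-\zeta\Big\}. \]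 Then $\hat M_{\rm PT}$ is the solution in $M$ of \[ \inf_{\boldsymbol\Delta:|\Sigma^{-1/2}\boldsymbol\Delta|\le\mathbf b}\mathrm P_{\boldsymbol\Delta}\big((\hat{\boldsymbol\tau}_{\rm PT}-\boldsymbol\tau)^\top(\Sigma_0^{-1}+\Sigma_1^{-1})(\hat{\boldsymbol\tau}_{\rm PT}-\boldsymbol\tau)\le M\big)=1-\zeta. \]
   Context: Let $d\ge1$, $\boldsymbol\tau\in\mathbb R^d$ unknown and $\boldsymbol\Delta\in\mathbb R^d$ an unknown bias. We observe independent random vectors $\hat{\boldsymbol\tau}_0\sim N_d(\boldsymbol\tau,\Sigma_0)$ and $\hat{\boldsymbol\tau}_1\sim N_d(\boldsymbol\tau+\boldsymbol\Delta,\Sigma_1)$, where $\Sigma_0,\Sigma_1$ are known symmetric positive definite matrices. Let $\Sigma$ be a fixed symmetric positive definite scaling matrix. Matrix square roots are symmetric square roots. Let $\mathbf b\in[0,\infty)^d$. The constraint $|\Sigma^{-1/2}\boldsymbol\Delta|\le\mathbf b$ means $|[\Sigma^{-1/2}\boldsymbol\Delta]_j|\le b_j$ for all $j$. $\Psi_d(\cdot;\lambda)$ is the CDF of the noncentral chi-squared distribution with $d$ degrees of freedom and noncentrality $\lambda$, i.e. the law of $\|\mathbf Z\|_2^2$ with $\mathbf Z\sim N(\boldsymbol\mu,I_d)$ and $\|\boldsymbol\mu\|_2^2=\lambda$. $\phi_{\boldsymbol\mu,I_d}$ is the density of $N(\boldsymbol\mu,I_d)$. Fix $\zeta\in(0,1)$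 and a threshold $q\ge0$. The pretest estimator is \[ \hat{\boldsymbol\tau}_{\rm PT}=\hat{\boldsymbol\tau}_0+(\Sigma_0^{-1}+\Sigma_1^{-1})^{-1}\Sigma_1^{-1}(\hat{\boldsymbol\tau}_1-\hat{\boldsymbol\tau}_0)\,\mathbf 1\big(\|(\Sigma_0+\Sigma_1)^{-1/2}(\hat{\boldsymbol\tau}_1-\hat{\boldsymbol\tau}_0)\|_2^2\le q\big). \] $\mathrm P_{\boldsymbol\Delta}$ denotes probability under bias $\boldsymbol\Delta$, and $\mathrm P_{\Sigma^{-1/2}\boldsymbol\Delta=\mathbf t}$ means probability under $\boldsymbol\Delta=\Sigma^{1/2}\mathbf t$. These probabilities do not depend on $\boldsymbol\tau$. *)

theory Defs
  imports "HOL-Probability.Probability"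
begin

definition spd_mat :: "real^'n^'n \<Rightarrow> bool" where
  "spd_mat A \<longleftrightarrow> transpose A = A \<and> (\<forall>x. x \<noteq> 0 \<longrightarrow> 0 < x \<bullet> (A *v x))"

definition msqrt :: "real^'n^'n \<Rightarrow> real^'n^'n" where
  "msqrt A = (THE S. transpose S = S \<and> (\<forall>x. 0 \<le> x \<bullet> (S *v x)) \<and> S ** S = A)"

definition gauss_density :: "real^'n \<Rightarrow> real^'n^'n \<Rightarrow> real^'n \<Rightarrow> real" where
  "gauss_density mu Sig x =
     (2 * pi) powr (- real CARD('n) / 2) * det Sig powr (-1/2) *
     exp (- ((x - mu) \<bullet> (matrix_inv Sig *v (x - mu))) / 2)"

definition gauss :: "real^'n \<Rightarrow> real^'n^'n \<Rightarrow> (real^'n) measure" where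
  "gauss mu Sig = density lborel (\<lambda>x. ennreal (gauss_density mu Sig x))"

text \<open>CDF of the noncentral chi-squared law with d = CARD('n) degrees of freedom
  and noncentrality lam: law of the squared norm of Z ~ N(mu, I) with norm mu ^ 2 = lam.\<close>
definition ncchi2_cdf :: "('n::finite) itself \<Rightarrow> real \<Rightarrow> real \<Rightarrow> real" where
  "ncchi2_cdf _ x lam =
     measure (gauss (SOME mu :: real^'n. norm mu ^ 2 = lam) (mat 1)) {z. norm z ^ 2 \<le> x}"

text \<open>The pretest estimator as a function of the observations x0 = tau_hat_0, x1 = tau_hat_1.\<close>
definition pt_est :: "real^'n^'n \<Rightarrow> real^'n^'n \<Rightarrow> real \<Rightarrow> real^'n \<Rightarrow> real^'n \<Rightarrow> real^'n" where
  "pt_est Sig0 Sig1 q x0 x1 =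
     x0 + (if (norm (matrix_inv (msqrt (Sig0 + Sig1)) *v (x1 - x0))) ^ 2 \<le> q
           then (matrix_inv (matrix_inv Sig0 + matrix_inv Sig1) ** matrix_inv Sig1) *v (x1 - x0)
           else 0)"

text \<open>P_Delta((tau_PT - tau)' (Sig0^-1 + Sig1^-1) (tau_PT - tau) <= M), with
  tau_hat_0 ~ N(tau, Sig0), tau_hat_1 ~ N(tau + Delta, Sig1) independent.\<close>
definition pt_prob :: "real^'n^'n \<Rightarrow> real^'n^'n \<Rightarrow> real \<Rightarrow> real^'n \<Rightarrow> real^'n \<Rightarrow> real \<Rightarrow> real" where
  "pt_prob Sig0 Sig1 q tau Delta M =
     measure (gauss tau Sig0 \<Otimes>\<^sub>M gauss (tau + Delta) Sig1)
       {p. (pt_est Sig0 Sig1 q (fst p) (snd p) - tau) \<bullet>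
           ((matrix_inv Sig0 + matrix_inv Sig1) *v (pt_est Sig0 Sig1 q (fst p) (snd p) - tau)) \<le> M}"

end

theory Submission
  imports Defs
begin

text \<open>(i) With \<open>P = S0\<^sup>-\<^sup>1 + S1\<^sup>-\<^sup>1\<close> and \<open>W = P\<^sup>-\<^sup>1 S1\<^sup>-\<^sup>1\<close>, the pooled estimator \<open>x0 + W (x1 - x0)\<close> is
  independent of the difference \<open>x1 - x0\<close>, because the product of the two Gaussian densities factors in
  these coordinates. Since the test depends on \<open>x1 - x0\<close> only, conditioning on the standardised
  difference \<open>u\<close> leaves a noncentral chi-squared probability for the loss.

  (ii) On the bounded set of admissible biases, the law of \<open>x1\<close> is dominated by, and dominates, constant
  multiples of two fixed Gaussians. Level sets of the loss are null and its shells have positive mass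
  under these, so the worst-case probability is continuous and strictly increasing in \<open>M \<ge> 0\<close>, vanishes
  for \<open>M < 0\<close> and tends to 1; hence it takes the value \<open>1 - \<zeta>\<close> exactly once. Attainment of the infimum
  is never needed.\<close>

subsection \<open>Linear change of variables\<close>

text \<open>The weight \<open>W\<close> is the one that decorrelates the pooled estimator from the
  difference: the cross-covariance is W (S0 + S1) - S0, and W (S0 + S1) = S0. For Gaussians this is
  independence, but the argument stays with densities, so the independence appears as a completed
  square together with a determinant identity. Two notions are given by description or choice:
  \<open>msqrt\<close> by \<open>THE\<close> and \<open>ncchi2_cdf\<close> by \<open>SOME\<close>.
  Before anything can be computed, positive definite roots need existence and uniqueness, and the
  mass of a centred ball needs invariance under rotations of the mean. Part (ii) does not go through
  the formula of part (i), where the bias enters both the noncentralities and the density. It keeps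
  the loss as one fixed function of the two observations and lets only the law of the second
  observation vary with the bias. A uniform comparison of these laws then replaces any study of the
  probability as a function of the bias.\<close>

lemma measurable_matrix_vector_mult [measurable]:
  fixes A :: "real^'n^'m"
  shows "f \<in> borel_measurable M \<Longrightarrow> (\<lambda>x. A *v f x) \<in> borel_measurable M"
  by (rule measurable_compose[of f M borel])
     (auto intro!: borel_measurable_continuous_onI linear_continuous_on
       simp: linear_conv_bounded_linear[symmetric])

text \<open>With the coordinate \<open>e\<close> integrated innermost, \<open>h\<close> is constant
  along the inner integral, so the shear is there a mere translation. This is the row-addition case
  of the matrix change of variables.\<close>

lemma nn_integral_lborel_coordinate_shear:
  fixes f :: "'a::euclidean_space \<Rightarrow> ennreal" and h :: "'a \<Rightarrow> real"
  assumes f[measurable]: "f \<in> borel_measurable borel" and h[measurable]: "h \<in> borel_measurable borel"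
    and e: "e \<in> Basis" and h_indep: "\<And>x y. h (x + y *\<^sub>R e) = h x"
  shows "(\<integral>\<^sup>+x. f x \<partial>lborel) = (\<integral>\<^sup>+x. f (x + h x *\<^sub>R e) \<partial>lborel)"
proof -
  interpret product_sigma_finite "\<lambda>_::'a. lborel :: real measure"
    by standard
  let ?J = "Basis - {e} :: 'a set"
  have J: "finite ?J" "e \<notin> ?J" "insert e ?J = Basis"
    using e by auto
  define T where "T = (\<lambda>g::'a \<Rightarrow> real. \<Sum>b\<in>Basis. g b *\<^sub>R b)"
  have TM[measurable]: "T \<in> borel_measurable (\<Pi>\<^sub>M b\<in>Basis. lborel)"
    unfolding T_def by measurable
  have T_upd: "T (x(e := y)) = (\<Sum>b\<in>?J. x b *\<^sub>R b) + y *\<^sub>R e" for x y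
    unfolding T_def by (subst sum.remove[OF _ e]) (auto intro!: sum.cong simp: add.commute)
  have fubini: "(\<integral>\<^sup>+x. F x \<partial>lborel)
      = (\<integral>\<^sup>+x. \<integral>\<^sup>+y. F ((\<Sum>b\<in>?J. x b *\<^sub>R b) + y *\<^sub>R e) \<partial>lborel \<partial>(\<Pi>\<^sub>M b\<in>?J. lborel))"
    if F[measurable]: "F \<in> borel_measurable borel" for F :: "'a \<Rightarrow> ennreal"
  proof -
    have "(\<integral>\<^sup>+x. F x \<partial>lborel) = (\<integral>\<^sup>+g. F (T g) \<partial>(\<Pi>\<^sub>M b\<in>Basis. lborel))"
      unfolding T_def by (subst lborel_def) (simp add: lborel_eq_real[symmetric] nn_integral_distr)
    also have "\<dots> = (\<integral>\<^sup>+g. F (T g) \<partial>(\<Pi>\<^sub>M b\<in>insert e ?J. lborel))"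
      unfolding J(3) ..
    also have "\<dots> = (\<integral>\<^sup>+x. \<integral>\<^sup>+y. F (T (x(e := y))) \<partial>lborel \<partial>(\<Pi>\<^sub>M b\<in>?J. lborel))"
      by (rule product_nn_integral_insert) (use J in \<open>simp_all only: J, measurable\<close>)
    finally show ?thesis unfolding T_upd .
  qed
  have "(\<integral>\<^sup>+x. f (x + h x *\<^sub>R e) \<partial>lborel)
      = (\<integral>\<^sup>+x. \<integral>\<^sup>+y. f ((\<Sum>b\<in>?J. x b *\<^sub>R b) + (h (\<Sum>b\<in>?J. x b *\<^sub>R b) + 1 * y) *\<^sub>R e) \<partial>lborel \<partial>(\<Pi>\<^sub>M b\<in>?J. lborel))"
    by (subst fubini, measurable, simp add: h_indep, simp add: algebra_simps)
  also have "\<dots> = (\<integral>\<^sup>+x. \<integral>\<^sup>+y. f ((\<Sum>b\<in>?J. x b *\<^sub>R b) + y *\<^sub>R e) \<partial>lborel \<partial>(\<Pi>\<^sub>M b\<in>?J. lborel))"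
  proof (rule nn_integral_cong)
    fix x
    let ?g = "\<lambda>y. f ((\<Sum>b\<in>?J. x b *\<^sub>R b) + y *\<^sub>R e)"
    have "?g \<in> borel_measurable borel" by measurable
    from nn_integral_real_affine[OF this, of 1 "h (\<Sum>b\<in>?J. x b *\<^sub>R b)"]
    show "(\<integral>\<^sup>+y. f ((\<Sum>b\<in>?J. x b *\<^sub>R b) + (h (\<Sum>b\<in>?J. x b *\<^sub>R b) + 1 * y) *\<^sub>R e) \<partial>lborel)
      = (\<integral>\<^sup>+y. ?g y \<partial>lborel)" by simp
  qed
  also have "\<dots> = (\<integral>\<^sup>+x. f x \<partial>lborel)"
    by (rule fubini[symmetric]) simp
  finally show ?thesis ..
qed

text \<open>The change of variables theorems of the library require a well-ordered index type; the
  elementary row operations used here work for every finite one.\<close>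

theorem nn_integral_lborel_matrix:
  fixes A :: "real^'n^'n"
  assumes "det A \<noteq> 0" and "f \<in> borel_measurable borel"
  shows "(\<integral>\<^sup>+x. f x \<partial>lborel) = ennreal \<bar>det A\<bar> * (\<integral>\<^sup>+x. f (A *v x) \<partial>lborel)"
proof -
  \<comment> \<open>The integrand is quantified inside \<open>P\<close> because the product case
    uses the hypothesis on \<open>B\<close> for the composed integrand \<open>f (A *v x)\<close>.
    The implication makes the case of a zero row vacuous.\<close>
  define P where "P A \<longleftrightarrow> (det A \<noteq> 0 \<longrightarrow> (\<forall>f\<in>borel_measurable borel.
      (\<integral>\<^sup>+x. f x \<partial>lborel) = ennreal \<bar>det A\<bar> * (\<integral>\<^sup>+x. f (A *v x) \<partial>lborel)))" for A :: "real^'n^'n"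
  have "P A"
  proof (rule induct_matrix_elementary[where P=P])
    fix A B :: "real^'n^'n"
    assume A: "P A" and B: "P B"
    show "P (A ** B)"
    unfolding P_def
    proof (intro impI ballI)
      fix f :: "real^'n \<Rightarrow> ennreal" assume d: "det (A ** B) \<noteq> 0" and f[measurable]: "f \<in> borel_measurable borel"
      have "det A \<noteq> 0" "det B \<noteq> 0" using d by (auto simp: det_mul)
      moreover have "(\<lambda>x. f (A *v x)) \<in> borel_measurable borel" by measurable
      ultimately have fA: "(\<integral>\<^sup>+x. f x \<partial>lborel) = ennreal \<bar>det A\<bar> * (\<integral>\<^sup>+x. f (A *v x) \<partial>lborel)"
        and fB: "(\<integral>\<^sup>+x. f (A *v x) \<partial>lborel) = ennreal \<bar>det B\<bar> * (\<integral>\<^sup>+x. f (A *v (B *v x)) \<partial>lborel)"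
        using A B f unfolding P_def by blast+
      show "(\<integral>\<^sup>+x. f x \<partial>lborel) = ennreal \<bar>det (A ** B)\<bar> * (\<integral>\<^sup>+x. f ((A ** B) *v x) \<partial>lborel)"
        unfolding fA fB by (simp add: det_mul abs_mult ennreal_mult mult.assoc matrix_vector_mul_assoc)
    qed
  next
    fix A :: "real^'n^'n" and i assume "row i A = 0"
    then show "P A" by (simp add: P_def det_zero_row)
  next
    fix A :: "real^'n^'n" assume A: "\<And>i j. i \<noteq> j \<Longrightarrow> A $ i $ j = 0"
    show "P A"
    unfolding P_def
    proof (intro impI ballI)
      fix f :: "real^'n \<Rightarrow> ennreal" assume d: "det A \<noteq> 0" and f[measurable]: "f \<in> borel_measurable borel"
      have det: "det A = (\<Prod>i\<in>UNIV. A $ i $ i)" by (rule det_diagonal) (rule A)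
      have inj: "inj (\<lambda>i. axis i (1::real))" by (auto simp: inj_on_def axis_eq_axis)
      have Basis: "(Basis :: (real^'n) set) = range (\<lambda>i. axis i 1)" by (auto simp: Basis_vec_def)
      \<comment> \<open>The diagonal entries, indexed by basis vectors to fit
        \<open>lborel_affine_euclidean\<close>.\<close>
      define c where "c b = b \<bullet> (A *v b)" for b
      have c_axis: "c (axis i 1) = A $ i $ i" for i
        by (simp add: c_def inner_axis' matrix_vector_mult_basis column_def)
      have c0: "c b \<noteq> 0" if "b \<in> Basis" for b
        using that d by (auto simp: Basis c_axis det prod_zero_iff)
      have T: "0 + (\<Sum>j\<in>Basis. (c j * (x \<bullet> j)) *\<^sub>R j) = A *v x" for x
      proof -
        have "(A *v x) $ i = A $ i $ i * x $ i" for i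
          using A by (simp add: matrix_vector_mult_def) (subst sum.remove[of _ i], auto intro!: sum.neutral)
        moreover have "(\<Sum>j\<in>Basis. (c j * (x \<bullet> j)) *\<^sub>R j) $ i = A $ i $ i * x $ i" for i
          by (simp add: Basis sum.reindex[OF inj] c_axis inner_axis)
             (subst sum.remove[of _ i], auto intro!: sum.neutral simp: axis_def)
        ultimately show ?thesis by (simp add: vec_eq_iff)
      qed
      have "(\<Prod>j\<in>Basis. \<bar>c j\<bar>) = \<bar>det A\<bar>"
        by (simp add: Basis prod.reindex[OF inj] c_axis det abs_prod)
      then have "lborel = density (distr lborel borel ((*v) A)) (\<lambda>_. ennreal \<bar>det A\<bar>)"
        using lborel_affine_euclidean[of c 0] c0 by (simp add: T[simplified])
      then have "(\<integral>\<^sup>+x. f x \<partial>lborel) = (\<integral>\<^sup>+x. f x \<partial>density (distr lborel borel ((*v) A)) (\<lambda>_. ennreal \<bar>det A\<bar>))"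
        by simp
      then show "(\<integral>\<^sup>+x. f x \<partial>lborel) = ennreal \<bar>det A\<bar> * (\<integral>\<^sup>+x. f (A *v x) \<partial>lborel)"
        by (simp add: nn_integral_density nn_integral_distr nn_integral_cmult)
    qed
  next
    fix m n :: 'n assume "m \<noteq> n"
    let ?s = "Transposition.transpose m n"
    let ?A = "(\<chi> i j. mat 1 $ i $ ?s j) :: real^'n^'n"
    have Av: "?A *v x = (\<chi> i. x $ ?s i)" for x
    proof -
      have "(if i = ?s j then 1 else 0) * x $ j = (if j = ?s i then x $ j else 0)" for i j
        by auto
      then show ?thesis
        by (auto simp: vec_eq_iff matrix_vector_mult_def mat_def)
    qed
    have s: "bij ?s" by simp
    have det: "\<bar>det ?A\<bar> = 1"
      using \<open>m \<noteq> n\<close> by (simp add: det_permute_columns permutes_swap_id sign_swap_id abs_mult)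
    \<comment> \<open>Lebesgue measure is determined by its values on boxes, and swapping two
      coordinates only permutes the side lengths of a box.\<close>
    have lb: "lborel = distr lborel borel ((*v) ?A)"
    proof (rule lborel_eqI)
      fix l u :: "real^'n" assume lu: "\<And>b. b \<in> Basis \<Longrightarrow> l \<bullet> b \<le> u \<bullet> b"
      have lu': "l $ i \<le> u $ i" for i using lu[of "axis i 1"] by (simp add: inner_axis)
      have inj: "inj (\<lambda>i. axis i (1::real))" by (auto simp: inj_on_def axis_eq_axis)
      have Basis: "(Basis :: (real^'n) set) = range (\<lambda>i. axis i 1)" by (auto simp: Basis_vec_def)
      have "((*v) ?A) -` box l u = box (\<chi> i. l $ ?s i) (\<chi> i. u $ ?s i)"
        by (auto simp: mem_box_cart Av) (metis transpose_involutory)+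
      then have "emeasure (distr lborel borel ((*v) ?A)) (box l u) = emeasure lborel (box (\<chi> i. l $ ?s i) (\<chi> i. u $ ?s i))"
        by (subst emeasure_distr) auto
      also have "\<dots> = (\<Prod>b\<in>Basis. ((\<chi> i. u $ ?s i) - (\<chi> i. l $ ?s i)) \<bullet> b)"
        by (rule emeasure_lborel_box) (auto simp: Basis inner_axis lu')
      also have "(\<Prod>b\<in>Basis. ((\<chi> i. u $ ?s i) - (\<chi> i. l $ ?s i)) \<bullet> b) = (\<Prod>i\<in>UNIV. u $ ?s i - l $ ?s i)"
        by (simp add: Basis prod.reindex[OF inj] inner_axis)
      also have "\<dots> = (\<Prod>i\<in>UNIV. u $ i - l $ i)"
        by (rule prod.reindex_bij_betw[OF s])
      also have "\<dots> = (\<Prod>b\<in>Basis. (u - l) \<bullet> b)"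
        by (simp add: Basis prod.reindex[OF inj] inner_axis)
      finally show "emeasure (distr lborel borel ((*v) ?A)) (box l u) = (\<Prod>b\<in>Basis. (u - l) \<bullet> b)" .
    qed simp
    show "P ?A"
    unfolding P_def
    proof (intro impI ballI)
      fix f :: "real^'n \<Rightarrow> ennreal" assume f[measurable]: "f \<in> borel_measurable borel"
      show "(\<integral>\<^sup>+x. f x \<partial>lborel) = ennreal \<bar>det ?A\<bar> * (\<integral>\<^sup>+x. f (?A *v x) \<partial>lborel)"
        unfolding det by (subst lb) (simp add: nn_integral_distr)
    qed
  next
    fix m n :: 'n and c :: real assume mn: "m \<noteq> n"
    let ?A = "(\<chi> i j. if i = m \<and> j = n then c else of_bool (i = j)) :: real^'n^'n"
    have Av: "?A *v x = x + (c * x $ n) *\<^sub>R axis m 1" for x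
    proof -
      have "(\<Sum>j\<in>UNIV. (if i = m \<and> j = n then c else of_bool (i = j)) * x $ j)
          = (\<Sum>j\<in>UNIV. (if j = i then x $ j else 0) + (if j = n then (if i = m then c * x $ j else 0) else 0))" for i
        by (rule sum.cong) (use mn in auto)
      then show ?thesis
        by (auto simp: vec_eq_iff matrix_vector_mult_def axis_def sum.distrib)
    qed
    have "?A = (\<chi> k. if k = m then row m (mat 1) + c *s row n (mat 1) else row k (mat 1))"
      using mn by (auto simp: vec_eq_iff row_def mat_def)
    then have det: "det ?A = 1" using det_row_operation[OF mn, of "mat 1" c] by simp
    show "P ?A"
    unfolding P_def
    proof (intro impI ballI)
      fix f :: "real^'n \<Rightarrow> ennreal" assume f[measurable]: "f \<in> borel_measurable borel"
      have "(\<integral>\<^sup>+x. f x \<partial>lborel) = (\<integral>\<^sup>+x. f (x + (c * x $ n) *\<^sub>R axis m 1) \<partial>lborel)"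
        using mn by (intro nn_integral_lborel_coordinate_shear) (auto simp: Basis_vec_def axis_def)
      then show "(\<integral>\<^sup>+x. f x \<partial>lborel) = ennreal \<bar>det ?A\<bar> * (\<integral>\<^sup>+x. f (?A *v x) \<partial>lborel)"
        unfolding det Av by simp
    qed
  qed
  then show ?thesis unfolding P_def using assms by (elim impE bspec)
qed

lemma nn_integral_lborel_plus:
  fixes f :: "'a::euclidean_space \<Rightarrow> ennreal"
  assumes [measurable]: "f \<in> borel_measurable borel"
  shows "(\<integral>\<^sup>+x. f (c + x) \<partial>lborel) = (\<integral>\<^sup>+x. f x \<partial>lborel)"
  by (subst (2) lborel_distr_plus[of c, symmetric]) (simp add: nn_integral_distr)

subsection \<open>Positive definite matrices and their square roots\<close>

lemma symmetric_matrix_inner: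
  fixes A :: "real^'n^'n"
  assumes "transpose A = A"
  shows "(A *v x) \<bullet> y = x \<bullet> (A *v y)"
  using assms dot_lmul_matrix[of x A y] by (metis transpose_matrix_vector)

lemma symmetric_matrixI:
  fixes A :: "real^'n^'n"
  assumes "\<And>x y. (A *v x) \<bullet> y = x \<bullet> (A *v y)"
  shows "transpose A = A"
proof -
  have "y \<bullet> (transpose A *v x) = y \<bullet> (A *v x)" for x y
    by (metis assms dot_lmul_matrix inner_commute transpose_matrix_vector)
  then show ?thesis by (metis matrix_eq vector_eq_ldot)
qed

lemma
  fixes A :: "real^'n^'n"
  assumes "invertible A"
  shows matrix_inv_mult_left: "matrix_inv A ** A = mat 1"
    and matrix_inv_mult_right: "A ** matrix_inv A = mat 1"
  using someI_ex[OF assms[unfolded invertible_def]] unfolding matrix_inv_def by auto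

lemma
  fixes A :: "real^'n^'n"
  assumes "invertible A"
  shows matrix_inv_apply_left: "matrix_inv A *v (A *v x) = x"
    and matrix_inv_apply_right: "A *v (matrix_inv A *v x) = x"
  by (simp_all add: assms matrix_vector_mul_assoc matrix_inv_mult_left matrix_inv_mult_right)

lemma matrix_inv_unique:
  fixes A B :: "real^'n^'n"
  assumes "B ** A = mat 1"
  shows "matrix_inv A = B"
  by (metis assms invertible_left_inverse matrix_inv_mult_right matrix_mul_assoc matrix_mul_lid matrix_mul_rid)

lemma spd_mat_invertible:
  assumes "spd_mat A"
  shows "invertible A"
  unfolding invertible_left_inverse matrix_left_invertible_ker
  using assms by (auto simp: spd_mat_def)

lemma spd_mat_inner: "spd_mat A \<Longrightarrow> (A *v x) \<bullet> y = x \<bullet> (A *v y)"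
  by (simp add: spd_mat_def symmetric_matrix_inner)

lemma spd_mat_nonneg: "spd_mat A \<Longrightarrow> 0 \<le> x \<bullet> (A *v x)"
  by (cases "x = 0") (auto simp: spd_mat_def intro: less_imp_le)

lemma spd_mat_add: "spd_mat A \<Longrightarrow> spd_mat B \<Longrightarrow> spd_mat (A + B)"
  by (auto simp: spd_mat_def matrix_vector_mult_add_rdistrib inner_add_right transpose_def vec_eq_iff add_pos_pos)

lemma spd_mat_scaleR: "spd_mat A \<Longrightarrow> 0 < c \<Longrightarrow> spd_mat (c *\<^sub>R A)"
  by (auto simp: spd_mat_def transpose_def vec_eq_iff scaleR_matrix_vector_assoc[symmetric])

lemma spd_mat_inv:
  assumes "spd_mat A"
  shows "spd_mat (matrix_inv A)"
proof -
  note inv = matrix_inv_apply_right[OF spd_mat_invertible[OF assms]]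
  have "transpose (matrix_inv A) = matrix_inv A"
  proof (rule symmetric_matrixI)
    fix x y
    show "(matrix_inv A *v x) \<bullet> y = x \<bullet> (matrix_inv A *v y)"
      using spd_mat_inner[OF assms, of "matrix_inv A *v x" "matrix_inv A *v y"] by (simp add: inv)
  qed
  moreover have "0 < x \<bullet> (matrix_inv A *v x)" if "x \<noteq> 0" for x
  proof -
    have "matrix_inv A *v x \<noteq> 0" using that inv[of x] by auto
    then show ?thesis using assms inv[of x] unfolding spd_mat_def by (metis inner_commute)
  qed
  ultimately show ?thesis by (simp add: spd_mat_def)
qed

text \<open>With \<open>C = I - \<epsilon> A\<close> of operator norm below 1, the map \<open>X \<mapsto> (C + X\<^sup>2) / 2\<close> is a contraction of a
  small ball of self-adjoint operators, and its fixed point satisfies \<open>(I - X)\<^sup>2 = \<epsilon> A\<close>.\<close>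

lemma spd_sqrt_exists:
  fixes A :: "real^'n^'n"
  assumes A: "spd_mat A"
  shows "\<exists>S. spd_mat S \<and> S ** S = A"
proof -
  have cont: "continuous_on (sphere 0 1) (\<lambda>x. x \<bullet> (A *v x))"
    by (intro continuous_intros linear_continuous_on) (simp add: linear_conv_bounded_linear[symmetric])
  obtain x0 where x0: "x0 \<in> sphere 0 1" "\<And>x. x \<in> sphere 0 1 \<Longrightarrow> x0 \<bullet> (A *v x0) \<le> x \<bullet> (A *v x)"
    using continuous_attains_inf[OF compact_sphere _ cont] by auto
  define m where "m = x0 \<bullet> (A *v x0)"
  have m: "0 < m" using A x0(1) unfolding m_def spd_mat_def by (metis norm_zero mem_sphere_0 zero_neq_one)
  have lower: "m * (norm x)\<^sup>2 \<le> x \<bullet> (A *v x)" for x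
  proof (cases "x = 0")
    case False
    then have "m \<le> (x /\<^sub>R norm x) \<bullet> (A *v (x /\<^sub>R norm x))" unfolding m_def by (intro x0(2)) simp
    also have "\<dots> = x \<bullet> (A *v x) / (norm x)\<^sup>2"
      by (simp add: matrix_vector_mult_scaleR field_simps power2_eq_square)
    finally show ?thesis using False by (simp add: field_simps)
  qed simp
  obtain N where N: "0 < N" "\<And>x. norm (A *v x) \<le> norm x * N"
    using bounded_linear.pos_bounded[of "(*v) A"] by (auto simp: linear_conv_bounded_linear[symmetric])
  have "m \<le> norm x0 * norm (A *v x0)" unfolding m_def by (rule norm_cauchy_schwarz)
  then have mN: "m \<le> N" using N(2)[of x0] x0(1) by simp
  \<comment> \<open>This value minimises 1 - 2 e m + e^2 N^2, the bound obtained below for the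
    squared norm of I - e A. The minimum is 1 - m^2 / N^2, which is the square of
    \<open>r\<close>.\<close>
  define e where "e = m / N\<^sup>2"
  have e: "0 < e" using m N by (simp add: e_def)
  define r where "r = sqrt (1 - m\<^sup>2 / N\<^sup>2)"
  have r0: "0 \<le> r" and r1: "r < 1" using m mN N(1) by (auto simp: r_def power_mono)
  have r2: "r\<^sup>2 = 1 - 2 * e * m + e\<^sup>2 * N\<^sup>2"
  proof -
    have "m\<^sup>2 / N\<^sup>2 \<le> 1" using m mN N(1) by (simp add: power_mono)
    then show ?thesis using N(1) by (simp add: r_def e_def field_simps power2_eq_square)
  qed
  define C where "C = Blinfun (\<lambda>x. x - e *\<^sub>R (A *v x))"
  have C: "blinfun_apply C x = x - e *\<^sub>R (A *v x)" for x
  proof -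
    have "linear (\<lambda>x. x - e *\<^sub>R (A *v x))"
      by (rule linearI) (simp_all add: algebra_simps matrix_vector_right_distrib matrix_vector_mult_scaleR)
    then show ?thesis
      unfolding C_def by (simp add: bounded_linear_Blinfun_apply linear_conv_bounded_linear)
  qed
  have normC: "norm C \<le> r"
  proof (rule norm_blinfun_bound[OF r0])
    fix x
    have "(norm (C x))\<^sup>2 = (norm x)\<^sup>2 - 2 * e * (x \<bullet> (A *v x)) + e\<^sup>2 * (norm (A *v x))\<^sup>2"
      unfolding power2_norm_eq_inner C
      by (simp add: inner_simps inner_commute) (simp add: power2_eq_square algebra_simps)
    also have "\<dots> \<le> (norm x)\<^sup>2 - 2 * e * (m * (norm x)\<^sup>2) + e\<^sup>2 * (norm x * N)\<^sup>2"
      using lower[of x] N(2)[of x] e by (intro add_mono diff_mono mult_left_mono power_mono) auto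
    also have "\<dots> = (r * norm x)\<^sup>2" by (simp add: power_mult_distrib r2 algebra_simps)
    finally show "norm (C x) \<le> r * norm x" using r0 by (simp add: power2_le_iff_abs_le abs_mult)
  qed
  \<comment> \<open>\<open>p\<close> serves both as radius of the ball and as contraction constant.
    The ball is mapped into itself if (r + p^2) / 2 \<le> p, and for this \<open>p\<close> the
    difference 2 p - p^2 - r equals (1 - r) (3 + r) / 4.\<close>
  define p where "p = (1 + r) / 2"
  have p: "0 \<le> p" "p < 1" using r0 r1 by (auto simp: p_def)
  have "0 \<le> (1 - r) * (3 + r)" using r0 r1 by simp
  then have rp: "(r + p * p) / 2 \<le> p" by (simp add: p_def field_simps)
  \<comment> \<open>Self-adjointness is a closed condition that \<open>G\<close> preserves, so it
    passes to the fixed point and makes the root symmetric.\<close>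
  define K where "K = {X :: (real^'n) \<Rightarrow>\<^sub>L (real^'n). norm X \<le> p \<and> (\<forall>x y. blinfun_apply X x \<bullet> y = x \<bullet> blinfun_apply X y)}"
  define G where "G X = (1/2) *\<^sub>R (C + (X o\<^sub>L X))" for X :: "(real^'n) \<Rightarrow>\<^sub>L (real^'n)"
  have "closed K" unfolding K_def
    by (intro closed_Collect_conj closed_Collect_all closed_Collect_le closed_Collect_eq continuous_intros)
  note complete_eq_closed[THEN iffD2, OF this]
  moreover have "K \<noteq> {}" using p by (auto simp: K_def intro!: exI[of _ 0])
  moreover have "G ` K \<subseteq> K"
  proof clarify
    fix X assume X: "X \<in> K"
    have "norm (G X) \<le> (1/2) * (norm C + norm (X o\<^sub>L X))"
      unfolding G_def by (simp add: norm_triangle_ineq)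
    also have "\<dots> \<le> (1/2) * (r + p * p)"
      using normC norm_blinfun_compose[of X X] X p
      by (intro mult_left_mono add_mono order_trans[OF norm_blinfun_compose] mult_mono) (auto simp: K_def)
    also have "\<dots> \<le> p" using rp by simp
    finally have "norm (G X) \<le> p" .
    moreover have "G X x \<bullet> y = x \<bullet> G X y" for x y
      using X by (simp add: G_def K_def C blinfun.bilinear_simps inner_simps spd_mat_inner[OF A])
    ultimately show "G X \<in> K" by (simp add: K_def)
  qed
  moreover have "dist (G X) (G Y) \<le> p * dist X Y" if "X \<in> K" "Y \<in> K" for X Y
  proof -
    \<comment> \<open>X^2 - Y^2 is split so that no commutation of X and Y is used.\<close>
    have "G X - G Y = (1/2) *\<^sub>R ((X o\<^sub>L (X - Y)) + ((X - Y) o\<^sub>L Y))"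
      by (rule blinfun_eqI) (simp add: G_def blinfun.bilinear_simps algebra_simps)
    then have "dist (G X) (G Y) = (1/2) * norm ((X o\<^sub>L (X - Y)) + ((X - Y) o\<^sub>L Y))"
      by (simp add: dist_norm)
    also have "\<dots> \<le> (1/2) * (norm X * norm (X - Y) + norm (X - Y) * norm Y)"
      by (intro mult_left_mono norm_triangle_le add_mono norm_blinfun_compose) auto
    also have "\<dots> \<le> (1/2) * (p * norm (X - Y) + norm (X - Y) * p)"
      using that p by (intro mult_left_mono add_mono mult_mono) (auto simp: K_def)
    also have "\<dots> = p * dist X Y" by (simp add: dist_norm)
    finally show ?thesis .
  qed
  ultimately obtain X where X: "X \<in> K" "G X = X"
    using Banach_fix[of K p G] p by blast
  have XX: "blinfun_apply X (blinfun_apply X x) = 2 *\<^sub>R X x - C x" for x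
  proof -
    have "2 *\<^sub>R X x = 2 *\<^sub>R (G X) x" using X by simp
    then show ?thesis by (simp add: G_def blinfun.bilinear_simps)
  qed
  \<comment> \<open>From (I - X)^2 = e A, the root of A is I - X divided by \<open>sqrt e\<close>.
    It is positive definite because X has norm at most \<open>p\<close>, which is below 1.\<close>
  define S where "S = matrix (\<lambda>x. (1 / sqrt e) *\<^sub>R (x - X x))"
  have S: "S *v x = (1 / sqrt e) *\<^sub>R (x - X x)" for x
  proof -
    have "linear (\<lambda>x. (1 / sqrt e) *\<^sub>R (x - blinfun_apply X x))"
      by (rule linearI) (auto simp: blinfun.bilinear_simps algebra_simps)
    then show ?thesis unfolding S_def by (rule fun_cong[OF matrix_vector_mul(2)])
  qed
  have "S ** S = A"
    unfolding matrix_eq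
  proof
    fix x
    have "(S ** S) *v x = (1 / e) *\<^sub>R (x - 2 *\<^sub>R X x + X (X x))"
      using e by (simp add: matrix_vector_mul_assoc[symmetric] S blinfun.bilinear_simps algebra_simps scaleR_2)
    also have "\<dots> = A *v x" using e by (simp add: XX C)
    finally show "(S ** S) *v x = A *v x" .
  qed
  moreover have "spd_mat S"
    unfolding spd_mat_def
  proof (intro conjI allI impI)
    show "transpose S = S"
      using X by (intro symmetric_matrixI) (simp add: S K_def inner_simps)
    fix x :: "real^'n" assume "x \<noteq> 0"
    have "x \<bullet> X x \<le> norm x * norm (X x)" by (rule norm_cauchy_schwarz)
    also have "\<dots> \<le> norm x * (norm X * norm x)" by (intro mult_left_mono norm_blinfun) auto
    also have "\<dots> \<le> norm x * (p * norm x)" using X by (intro mult_left_mono mult_right_mono) (auto simp: K_def)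
    also have "\<dots> < norm x * (1 * norm x)"
      using \<open>x \<noteq> 0\<close> p by (intro mult_strict_left_mono mult_strict_right_mono) auto
    also have "\<dots> = x \<bullet> x" by (metis mult_1 power2_eq_square power2_norm_eq_inner)
    finally show "0 < x \<bullet> (S *v x)" using e by (simp add: S inner_simps)
  qed
  ultimately show ?thesis by blast
qed

text \<open>If \<open>S\<^sup>2 = T\<^sup>2\<close> and \<open>D = S - T\<close>, then \<open>S D + D T = 0\<close>; multiplying by \<open>D\<^sup>T\<close> and taking traces
  gives two nonnegative terms, the first of which vanishes only if \<open>D = 0\<close>.\<close>

lemma psd_sqrt_unique:
  fixes S T :: "real^'n^'n"
  assumes S: "spd_mat S" and T: "transpose T = T" "\<And>x. 0 \<le> x \<bullet> (T *v x)" and eq: "S ** S = T ** T"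
  shows "T = S"
proof -
  define D where "D = S - T"
  have Dsym: "transpose D = D" using S T by (simp add: D_def spd_mat_def transpose_def vec_eq_iff)
  have "S ** D + D ** T = 0"
    unfolding matrix_eq using eq
    by (simp add: D_def matrix_vector_mult_add_rdistrib matrix_vector_mult_diff_rdistrib
        matrix_vector_mult_diff_distrib matrix_vector_mul_assoc[symmetric])
      (simp add: matrix_vector_mul_assoc)
  then have "trace (D ** (S ** D + D ** T)) = 0" by (simp add: trace_def)
  then have "trace (D ** (S ** D)) + trace (D ** (D ** T)) = 0"
    by (simp add: matrix_add_ldistrib trace_add)
  moreover have "trace (D ** (D ** T)) = trace (D ** (T ** D))"
    by (metis matrix_mul_assoc trace_mul_sym)
  \<comment> \<open>As D is symmetric, the diagonal entries of D M D are the values of the quadratic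
    form of M at the columns of D.\<close>
  moreover have tr: "trace (D ** (M ** D)) = (\<Sum>i\<in>UNIV. column i D \<bullet> (M *v column i D))" for M
  proof -
    have "(D ** (M ** D)) $ i $ i = column i D \<bullet> (M *v column i D)" for i
    proof -
      have "(D ** (M ** D)) $ i $ i = axis i 1 \<bullet> ((D ** (M ** D)) *v axis i 1)"
        by (simp add: matrix_vector_mult_basis column_def inner_axis')
      also have "\<dots> = (D *v axis i 1) \<bullet> (M *v (D *v axis i 1))"
        by (simp add: symmetric_matrix_inner[OF Dsym] matrix_vector_mul_assoc[symmetric])
      finally show ?thesis by (simp add: matrix_vector_mult_basis)
    qed
    then show ?thesis by (simp add: trace_def)
  qed
  moreover have "0 \<le> trace (D ** (T ** D))" unfolding tr by (intro sum_nonneg T)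
  ultimately have "(\<Sum>i\<in>UNIV. column i D \<bullet> (S *v column i D)) \<le> 0" by simp
  then have "column i D \<bullet> (S *v column i D) = 0" for i
    using spd_mat_nonneg[OF S] sum_nonneg[of UNIV "\<lambda>i. column i D \<bullet> (S *v column i D)"]
    by (metis (no_types, lifting) UNIV_I antisym finite sum_nonneg_eq_0_iff)
  then have "column i D = 0" for i using S unfolding spd_mat_def by (metis less_irrefl)
  then have "D = 0" by (simp add: column_def vec_eq_iff)
  then show ?thesis by (simp add: D_def)
qed

text \<open>The description in \<open>msqrt\<close> admits all semidefinite roots. Hence the
  definite root from \<open>spd_sqrt_exists\<close> has to be compared with merely semidefinite
  competitors, which explains the unequal hypotheses on \<open>S\<close> and \<open>T\<close> in
  \<open>psd_sqrt_unique\<close>.\<close>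

lemma
  assumes "spd_mat A"
  shows spd_mat_msqrt: "spd_mat (msqrt A)" and msqrt_mult_msqrt: "msqrt A ** msqrt A = A"
proof -
  obtain S where S: "spd_mat S" "S ** S = A" using spd_sqrt_exists[OF assms] by blast
  have "msqrt A = S" unfolding msqrt_def
  proof (rule the_equality)
    show "transpose S = S \<and> (\<forall>x. 0 \<le> x \<bullet> (S *v x)) \<and> S ** S = A"
      using S spd_mat_nonneg by (auto simp: spd_mat_def)
    fix T assume "transpose T = T \<and> (\<forall>x. 0 \<le> x \<bullet> (T *v x)) \<and> T ** T = A"
    then show "T = S" using S by (auto intro: psd_sqrt_unique[of S T])
  qed
  with S show "spd_mat (msqrt A)" "msqrt A ** msqrt A = A" by auto
qed

lemma det_spd_mat_pos:
  assumes "spd_mat A"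
  shows "0 < det A"
proof -
  have "det A = det (msqrt A) * det (msqrt A)" by (metis assms det_mul msqrt_mult_msqrt)
  moreover have "det (msqrt A) \<noteq> 0"
    using spd_mat_invertible[OF spd_mat_msqrt[OF assms]] by (simp add: invertible_det_nz)
  ultimately show ?thesis by (auto simp: zero_less_mult_iff linorder_neq_iff)
qed

subsection \<open>Gaussian measures\<close>

lemma measurable_gauss_density [measurable]:
  fixes A :: "real^'n^'n"
  assumes [measurable]: "f \<in> borel_measurable M" "g \<in> borel_measurable M"
  shows "(\<lambda>x. gauss_density (f x) A (g x)) \<in> borel_measurable M"
  unfolding gauss_density_def by measurable

lemma gauss_density_nonneg: "0 \<le> gauss_density mu A x"
  by (simp add: gauss_density_def)

lemma gauss_density_diff: "gauss_density (mu + c) A (x + c) = gauss_density mu A x"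
  by (simp add: gauss_density_def)

lemma matrix_inv_mat_1: "matrix_inv (mat 1 :: real^'n^'n) = mat 1"
  by (rule matrix_inv_unique) simp

lemma gauss_density_std:
  "gauss_density mu (mat 1) (x :: real^'n) = (2 * pi) powr (- real CARD('n) / 2) * exp (- (norm (x - mu))\<^sup>2 / 2)"
  by (simp add: gauss_density_def matrix_inv_mat_1 power2_norm_eq_inner)

text \<open>Standardisation: the Jacobian \<open>det S\<close> cancels the normalising factor, which
  is the inverse root of det (S^2), and S turns the precision form into the Euclidean one.\<close>

lemma gauss_density_sqrt:
  fixes S :: "real^'n^'n"
  assumes S: "spd_mat S"
  shows "det S * gauss_density mu (S ** S) (S *v u) = gauss_density (matrix_inv S *v mu) (mat 1) u"
proof -
  note inv = spd_mat_invertible[OF S] and d = det_spd_mat_pos[OF S]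
  have "matrix_inv (S ** S) = matrix_inv S ** matrix_inv S"
    by (rule matrix_inv_unique)
      (metis inv matrix_inv_mult_left matrix_mul_assoc matrix_mul_rid)
  then have "(S *v u - mu) \<bullet> (matrix_inv (S ** S) *v (S *v u - mu)) = (norm (matrix_inv S *v (S *v u - mu)))\<^sup>2"
    by (simp add: matrix_vector_mul_assoc[symmetric] power2_norm_eq_inner spd_mat_inner[OF spd_mat_inv[OF S]])
  also have "matrix_inv S *v (S *v u - mu) = u - matrix_inv S *v mu"
    by (simp add: matrix_vector_mult_diff_distrib matrix_inv_apply_left[OF inv])
  moreover have "det S * det (S ** S) powr (- 1 / 2) = 1"
    using d by (simp add: det_mul powr_mult powr_minus powr_half_sqrt field_simps)
  ultimately show ?thesis
    using d by (simp add: gauss_density_def[of mu] gauss_density_std)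
qed

lemma nn_integral_lborel_affine:
  fixes S :: "real^'n^'n"
  assumes "spd_mat S" and [measurable]: "f \<in> borel_measurable borel"
  shows "(\<integral>\<^sup>+x. f x \<partial>lborel) = ennreal (det S) * (\<integral>\<^sup>+x. f (a + S *v x) \<partial>lborel)"
  using nn_integral_lborel_matrix[of S "\<lambda>x. f (a + x)"] det_spd_mat_pos[OF assms(1)]
  by (simp add: nn_integral_lborel_plus)

text \<open>After standardising and recentring, the density is a product of one-dimensional standard
  normal densities.\<close>

lemma nn_integral_gauss_density:
  fixes A :: "real^'n^'n"
  assumes A: "spd_mat A"
  shows "(\<integral>\<^sup>+x. ennreal (gauss_density mu A x) \<partial>lborel) = 1"
proof -
  let ?S = "msqrt A"
  let ?m = "matrix_inv ?S *v mu"
  have std: "gauss_density 0 (mat 1) x = (\<Prod>b\<in>Basis. std_normal_density (x \<bullet> b))" for x :: "real^'n"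
  proof -
    have "(norm x)\<^sup>2 = (\<Sum>b\<in>Basis. (x \<bullet> b)\<^sup>2)"
      unfolding power2_norm_eq_inner by (subst euclidean_inner) (simp add: power2_eq_square)
    moreover have "(2 * pi) powr (- real CARD('n) / 2) = (1 / sqrt (2 * pi)) ^ CARD('n)"
      by (simp add: powr_minus powr_half_sqrt[symmetric] powr_powr powr_realpow[symmetric] field_simps powr_gt_zero)
    moreover have "(\<Prod>b\<in>Basis. std_normal_density (x \<bullet> b))
        = (\<Prod>b\<in>(Basis :: (real^'n) set). 1 / sqrt (2 * pi)) * exp (\<Sum>b\<in>Basis. - (x \<bullet> b)\<^sup>2 / 2)"
      by (simp only: std_normal_density_def prod.distrib exp_sum[OF finite_Basis])
    ultimately show ?thesis
      by (simp add: gauss_density_std sum_divide_distrib sum_negf)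
  qed
  have "(\<integral>\<^sup>+x. ennreal (gauss_density mu A x) \<partial>lborel)
      = ennreal (det ?S) * (\<integral>\<^sup>+x. ennreal (gauss_density mu (?S ** ?S) (?S *v x)) \<partial>lborel)"
    using nn_integral_lborel_affine[OF spd_mat_msqrt[OF A], of "\<lambda>x. ennreal (gauss_density mu A x)" 0]
    by (simp add: msqrt_mult_msqrt[OF A])
  also have "\<dots> = (\<integral>\<^sup>+x. ennreal (gauss_density ?m (mat 1) x) \<partial>lborel)"
    using det_spd_mat_pos[OF spd_mat_msqrt[OF A]]
    by (subst nn_integral_cmult[symmetric])
      (simp_all add: ennreal_mult[symmetric] gauss_density_nonneg gauss_density_sqrt spd_mat_msqrt[OF A])
  also have "\<dots> = (\<integral>\<^sup>+x. ennreal (gauss_density ?m (mat 1) (?m + x)) \<partial>lborel)"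
    by (subst nn_integral_lborel_plus) simp_all
  also have "\<dots> = (\<integral>\<^sup>+x. (\<Prod>b\<in>(Basis :: (real^'n) set). ennreal (std_normal_density (x \<bullet> b))) \<partial>lborel)"
    using gauss_density_diff[of 0 ?m] by (simp add: std prod_ennreal add.commute)
  also have "\<dots> = (\<Prod>b\<in>(Basis :: (real^'n) set). (\<integral>\<^sup>+x. ennreal (std_normal_density x) \<partial>lborel))"
    by (rule nn_integral_lborel_prod) simp_all
  also have "(\<integral>\<^sup>+x. ennreal (std_normal_density x) \<partial>lborel) = 1"
    by (subst nn_integral_eq_integral) (simp_all add: integrable_normal_moment_nz_1 integral_normal_density)
  finally show ?thesis by simp
qed

lemma sets_gauss [measurable_cong, simp]: "sets (gauss mu A) = sets borel"
  by (simp add: gauss_def)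

lemma space_gauss [simp]: "space (gauss mu A) = UNIV"
  by (simp add: gauss_def)

lemma prob_space_gauss:
  assumes "spd_mat A"
  shows "prob_space (gauss mu A)"
  by (rule prob_spaceI) (simp add: gauss_def emeasure_density nn_integral_gauss_density[OF assms])

lemma nn_integral_gauss:
  fixes A :: "real^'n^'n"
  assumes "f \<in> borel_measurable borel"
  shows "(\<integral>\<^sup>+x. f x \<partial>gauss mu A) = (\<integral>\<^sup>+x. ennreal (gauss_density mu A x) * f x \<partial>lborel)"
  unfolding gauss_def using assms by (subst nn_integral_density) auto

lemma emeasure_gauss:
  fixes A :: "real^'n^'n"
  assumes "X \<in> sets borel"
  shows "emeasure (gauss mu A) X = (\<integral>\<^sup>+x. ennreal (gauss_density mu A x) * indicator X x \<partial>lborel)"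
  unfolding gauss_def using assms by (subst emeasure_density) auto

lemma spd_mat_1: "spd_mat (mat 1 :: real^'n^'n)"
  by (simp add: spd_mat_def)

text \<open>Frees \<open>ncchi2_cdf\<close> from the mean picked by \<open>SOME\<close>: two means
  of equal norm differ by an orthogonal map, which preserves Lebesgue measure, the standard Gaussian
  kernel and centred balls.\<close>

lemma ncchi2_cdf_norm:
  fixes mu :: "real^'n"
  shows "ncchi2_cdf TYPE('n) M ((norm mu)\<^sup>2) = measure (gauss mu (mat 1)) {z. (norm z)\<^sup>2 \<le> M}"
proof -
  define mu' :: "real^'n" where "mu' = (SOME nu. (norm nu)\<^sup>2 = (norm mu)\<^sup>2)"
  have "(norm mu')\<^sup>2 = (norm mu)\<^sup>2" unfolding mu'_def by (rule someI[where x=mu]) simp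
  then have "norm mu' = norm mu" by simp
  then obtain f where f: "orthogonal_transformation f" "f mu' = mu"
    by (rule orthogonal_transformation_exists)
  have lin: "linear f" using f(1) by (simp add: orthogonal_transformation_linear)
  have Q: "matrix f *v x = f x" for x using matrix_vector_mul(2)[OF lin] by metis
  have "orthogonal_matrix (matrix f)" using f(1) by (simp add: orthogonal_transformation_matrix)
  then have det: "\<bar>det (matrix f)\<bar> = 1" using det_orthogonal_matrix by fastforce
  let ?X = "{z :: real^'n. (norm z)\<^sup>2 \<le> M}"
  have [measurable]: "?X \<in> sets borel" by measurable
  have "emeasure (gauss mu (mat 1)) ?X
      = (\<integral>\<^sup>+x. ennreal (gauss_density mu (mat 1) (matrix f *v x)) * indicator ?X (matrix f *v x) \<partial>lborel)"
    using det by (subst emeasure_gauss, simp, subst nn_integral_lborel_matrix[of "matrix f"]) auto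
  also have "\<dots> = emeasure (gauss mu' (mat 1)) ?X"
    unfolding emeasure_gauss[OF \<open>?X \<in> sets borel\<close>]
  proof (rule nn_integral_cong)
    fix x
    have "norm (f x - mu) = norm (x - mu')"
      unfolding f(2)[symmetric] linear_diff[OF lin, symmetric]
      by (rule orthogonal_transformation_norm[OF f(1)])
    then show "ennreal (gauss_density mu (mat 1) (matrix f *v x)) * indicator ?X (matrix f *v x)
        = ennreal (gauss_density mu' (mat 1) x) * indicator ?X x"
      by (simp add: Q gauss_density_std orthogonal_transformation_norm[OF f(1)] indicator_def)
  qed
  finally show ?thesis unfolding ncchi2_cdf_def mu'_def[symmetric] measure_def by simp
qed

lemma emeasure_gauss_std_ball:
  fixes m k :: "real^'n"
  shows "(\<integral>\<^sup>+v. ennreal (gauss_density m (mat 1) v) * indicator {v. (norm (v - k))\<^sup>2 \<le> M} v \<partial>lborel)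
    = ennreal (ncchi2_cdf TYPE('n) M ((norm (m - k))\<^sup>2))"
proof -
  interpret prob_space "gauss (m - k) (mat 1)" by (rule prob_space_gauss[OF spd_mat_1])
  have "(\<integral>\<^sup>+v. ennreal (gauss_density m (mat 1) v) * indicator {v. (norm (v - k))\<^sup>2 \<le> M} v \<partial>lborel)
      = (\<integral>\<^sup>+v. ennreal (gauss_density m (mat 1) (k + v)) * indicator {v. (norm (v - k))\<^sup>2 \<le> M} (k + v) \<partial>lborel)"
    by (rule nn_integral_lborel_plus[symmetric]) measurable
  also have "\<dots> = emeasure (gauss (m - k) (mat 1)) {z. (norm z)\<^sup>2 \<le> M}"
    using gauss_density_diff[of "m - k" k]
    by (subst emeasure_gauss) (auto intro!: nn_integral_cong simp: indicator_def add.commute)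
  finally show ?thesis by (simp add: ncchi2_cdf_norm emeasure_eq_measure)
qed

subsection \<open>The distribution of the pretest estimator\<close>

text \<open>Here \<open>y\<close> is the error of the pooled estimator and \<open>d\<close> the
  difference of the observations. The right-hand side is the product of the densities of the two,
  with covariances P^-1 and S0 + S1.\<close>

lemma gauss_density_precision_product:
  fixes S0 S1 :: "real^'n^'n" and Delta d :: "real^'n"
  defines "P \<equiv> matrix_inv S0 + matrix_inv S1"
  defines "W \<equiv> matrix_inv P ** matrix_inv S1"
  assumes S0: "spd_mat S0" and S1: "spd_mat S1"
  shows "gauss_density tau S0 (tau + y - W *v d) * gauss_density (tau + Delta) S1 (tau + y - W *v d + d)
    = gauss_density (W *v Delta) (matrix_inv P) y * gauss_density Delta (S0 + S1) d"
proof -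
  note inv0 = spd_mat_invertible[OF S0] and inv1 = spd_mat_invertible[OF S1]
  have T: "spd_mat (S0 + S1)" using S0 S1 by (rule spd_mat_add)
  note invT = spd_mat_invertible[OF T]
  have P: "spd_mat P" unfolding P_def using S0 S1 by (intro spd_mat_add spd_mat_inv)
  note invP = spd_mat_invertible[OF P]
  define z where "z = y - W *v Delta"
  \<comment> \<open>In terms of \<open>F\<close> the two residuals are z - S0 F and z + S1 F.
    Applying the respective precisions turns the shifts into -F and F, so the cross terms 2 z
    \<bullet> F cancel in the sum.\<close>
  define F where "F = matrix_inv (S0 + S1) *v (d - Delta)"
  have F: "d - Delta = S0 *v F + S1 *v F"
    unfolding F_def using matrix_inv_apply_right[OF invT, of "d - Delta"]
    by (simp add: matrix_vector_mult_add_rdistrib)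
  have PF: "P *v (S0 *v F) = matrix_inv S1 *v (d - Delta)"
    unfolding F P_def
    by (simp add: matrix_vector_mult_add_rdistrib matrix_vector_right_distrib
        matrix_inv_apply_left[OF inv0] matrix_inv_apply_left[OF inv1])
  have WF: "W *v d - W *v Delta = S0 *v F"
    using arg_cong[OF PF, of "\<lambda>v. matrix_inv P *v v"]
    by (simp add: W_def matrix_inv_apply_left[OF invP] matrix_vector_mul_assoc[symmetric] matrix_vector_mult_diff_distrib)
  have x0: "tau + y - W *v d - tau = z - S0 *v F"
    unfolding z_def using WF by (simp add: algebra_simps)
  have x1: "tau + y - W *v d + d - (tau + Delta) = z + S1 *v F"
    unfolding z_def using WF F by (simp add: algebra_simps)
  note inv0 = matrix_inv_apply_left[OF inv0] and inv1 = matrix_inv_apply_left[OF inv1]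
  have sym: "(matrix_inv S0 *v v) \<bullet> w = v \<bullet> (matrix_inv S0 *v w)" "(matrix_inv S1 *v v) \<bullet> w = v \<bullet> (matrix_inv S1 *v w)" for v w
    using S0 S1 by (auto intro!: spd_mat_inner spd_mat_inv)
  have q0: "(z - S0 *v F) \<bullet> (matrix_inv S0 *v (z - S0 *v F))
      = z \<bullet> (matrix_inv S0 *v z) - 2 * (z \<bullet> F) + F \<bullet> (S0 *v F)"
    using sym(1)[of "S0 *v F" z]
    by (simp add: matrix_vector_mult_diff_distrib inner_diff_left inner_diff_right inv0)
      (simp add: inner_commute)
  have q1: "(z + S1 *v F) \<bullet> (matrix_inv S1 *v (z + S1 *v F))
      = z \<bullet> (matrix_inv S1 *v z) + 2 * (z \<bullet> F) + F \<bullet> (S1 *v F)"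
    using sym(2)[of "S1 *v F" z]
    by (simp add: matrix_vector_right_distrib inner_add_left inner_add_right inv1)
      (simp add: inner_commute)
  have quad: "(z - S0 *v F) \<bullet> (matrix_inv S0 *v (z - S0 *v F)) + (z + S1 *v F) \<bullet> (matrix_inv S1 *v (z + S1 *v F))
      = z \<bullet> (P *v z) + (d - Delta) \<bullet> (matrix_inv (S0 + S1) *v (d - Delta))"
    unfolding q0 q1 F_def[symmetric]
    by (simp add: F P_def matrix_vector_mult_add_rdistrib inner_add_left inner_add_right inner_commute)
  \<comment> \<open>Source of the determinant identity that matches the normalising
    constants.\<close>
  have "S0 + S1 = S0 ** P ** S1"
    unfolding P_def matrix_eq
    by (simp add: matrix_vector_mul_assoc[symmetric] matrix_vector_mult_add_rdistrib matrix_vector_right_distrib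
        inv1 matrix_inv_apply_right spd_mat_invertible[OF S0] add.commute)
  then have "det (S0 + S1) = det S0 * det P * det S1" by (simp add: det_mul)
  moreover have "det (matrix_inv P) * det P = 1"
    by (simp add: det_mul[symmetric] matrix_inv_mult_left[OF invP])
  ultimately have det: "det S0 * det S1 = det (matrix_inv P) * det (S0 + S1)"
    using det_spd_mat_pos[OF P] by (simp add: field_simps)
  have pows: "det S0 powr (- 1 / 2) * det S1 powr (- 1 / 2)
      = det (matrix_inv P) powr (- 1 / 2) * det (S0 + S1) powr (- 1 / 2)"
    using det det_spd_mat_pos[OF S0] det_spd_mat_pos[OF S1] det_spd_mat_pos[OF T] det_spd_mat_pos[OF spd_mat_inv[OF P]]
    by (simp flip: powr_mult)
  have PP: "matrix_inv (matrix_inv P) = P"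
    by (rule matrix_inv_unique) (rule matrix_inv_mult_right[OF invP])
  have exps: "exp (- a / 2) * exp (- b / 2) = exp (- a' / 2) * exp (- b' / 2)" if "a + b = a' + b'" for a b a' b' :: real
    using that by (simp add: exp_add[symmetric] field_simps)
  show ?thesis
    using exps[OF quad] pows
    unfolding gauss_density_def x0 x1 PP z_def[symmetric] by (simp add: mult_ac)
qed

text \<open>The substitutions \<open>x1 = x0 + d\<close>, \<open>x0 = tau + y - W d\<close>, \<open>d = S u\<close>, \<open>y = R v\<close> turn the two observations
  into the independent standardised pair \<open>(v, u)\<close>, with \<open>y\<close> the error of the pooled estimator.\<close>

lemma pt_prob_emeasure:
  fixes S0 S1 :: "real^'n^'n" and Delta :: "real^'n"
  defines "R \<equiv> msqrt (matrix_inv (matrix_inv S0 + matrix_inv S1))" and "S \<equiv> msqrt (S0 + S1)"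
  assumes S0: "spd_mat S0" and S1: "spd_mat S1"
  shows "ennreal (pt_prob S0 S1 q tau Delta M) =
    (\<integral>\<^sup>+u. ennreal (ncchi2_cdf TYPE('n) M ((norm ((R ** matrix_inv S1) *v
        (Delta - (if (norm u)\<^sup>2 \<le> q then 0 else S *v u))))\<^sup>2))
      * ennreal (gauss_density (matrix_inv S *v Delta) (mat 1) u) \<partial>lborel)"
proof -
  define P where "P = matrix_inv S0 + matrix_inv S1"
  define W where "W = matrix_inv P ** matrix_inv S1"
  have P: "spd_mat P" unfolding P_def using S0 S1 by (intro spd_mat_add spd_mat_inv)
  have T: "spd_mat (S0 + S1)" using S0 S1 by (rule spd_mat_add)
  have R: "spd_mat R" and RR: "R ** R = matrix_inv P"
    unfolding R_def P_def[symmetric] by (simp_all add: spd_mat_msqrt msqrt_mult_msqrt spd_mat_inv P)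
  have S: "spd_mat S" and SS: "S ** S = S0 + S1"
    unfolding S_def by (simp_all add: spd_mat_msqrt msqrt_mult_msqrt T)
  note invR = spd_mat_invertible[OF R] and invS = spd_mat_invertible[OF S] and invP = spd_mat_invertible[OF P]
  define B where "B = R ** matrix_inv S1"
  have RB: "R *v (B *v x) = W *v x" for x
    by (simp add: B_def W_def matrix_vector_mul_assoc matrix_mul_assoc RR)
  have RW: "matrix_inv R *v (W *v x) = B *v x" for x
    unfolding RB[symmetric] by (rule matrix_inv_apply_left[OF invR])
  \<comment> \<open>\<open>R\<close> is the root of P^-1, so the loss becomes the squared Euclidean
    norm in the coordinate v with y = R v.\<close>
  have quad: "(R *v x) \<bullet> (P *v (R *v x)) = (norm x)\<^sup>2" for x
  proof -
    have "R *v (R *v (P *v (R *v x))) = R *v x"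
      unfolding matrix_vector_mul_assoc[of R R] RR by (rule matrix_inv_apply_left[OF invP])
    then have "R *v (P *v (R *v x)) = x" by (metis matrix_inv_apply_left[OF invR])
    then show ?thesis by (simp add: spd_mat_inner[OF R] power2_norm_eq_inner)
  qed
  \<comment> \<open>The error of the pretest estimator is \<open>y - h d\<close>: the pooled error
    if the test accepts, and y - W d, the error of the first observation alone, if it
    rejects.\<close>
  define h where "h d = (if (norm (matrix_inv S *v d))\<^sup>2 \<le> q then 0 else W *v d)" for d
  let ?Q = "\<lambda>x. x \<bullet> (P *v x)"
  let ?E = "\<lambda>x0 x1. pt_est S0 S1 q x0 x1 - tau"
  let ?X = "{p. ?Q (?E (fst p) (snd p)) \<le> M}"
  have pt[measurable]: "(\<lambda>p. pt_est S0 S1 q (f p) (g p)) \<in> borel_measurable N"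
    if [measurable]: "f \<in> borel_measurable N" "g \<in> borel_measurable N" for f g and N :: "'z measure"
    unfolding pt_est_def by measurable
  have E: "?E (tau + y - W *v d) (tau + y - W *v d + d) = y - h d" for y d
    by (simp add: pt_est_def h_def W_def P_def S_def)
  interpret g0: prob_space "gauss tau S0" by (rule prob_space_gauss[OF S0])
  interpret g1: prob_space "gauss (tau + Delta) S1" by (rule prob_space_gauss[OF S1])
  interpret g: pair_prob_space "gauss tau S0" "gauss (tau + Delta) S1" ..
  have X: "?X \<in> sets (gauss tau S0 \<Otimes>\<^sub>M gauss (tau + Delta) S1)"
  proof -
    have "?X = {p \<in> space (gauss tau S0 \<Otimes>\<^sub>M gauss (tau + Delta) S1). ?Q (?E (fst p) (snd p)) \<le> M}"
      by (simp add: space_pair_measure)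
    also have "\<dots> \<in> sets (gauss tau S0 \<Otimes>\<^sub>M gauss (tau + Delta) S1)" by measurable
    finally show ?thesis .
  qed
  let ?I = "\<lambda>x. indicator {..M} (?Q x) :: ennreal"
  have hm[measurable]: "h \<in> borel_measurable borel" unfolding h_def[abs_def] by measurable
  have "ennreal (pt_prob S0 S1 q tau Delta M) = emeasure (gauss tau S0 \<Otimes>\<^sub>M gauss (tau + Delta) S1) ?X"
    unfolding pt_prob_def P_def[symmetric] by (simp add: g.P.emeasure_eq_measure)
  also have "\<dots> = (\<integral>\<^sup>+x0. emeasure (gauss (tau + Delta) S1) (Pair x0 -` ?X) \<partial>gauss tau S0)"
    by (rule g1.emeasure_pair_measure_alt[OF X])
  also have "\<dots> = (\<integral>\<^sup>+x0. (\<integral>\<^sup>+x1. ?I (?E x0 x1) \<partial>gauss (tau + Delta) S1) \<partial>gauss tau S0)"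
  proof (rule nn_integral_cong)
    fix x0
    have "Pair x0 -` ?X \<in> sets (gauss (tau + Delta) S1)" by (rule sets_Pair1[OF X])
    then have "emeasure (gauss (tau + Delta) S1) (Pair x0 -` ?X) = (\<integral>\<^sup>+x1. indicator (Pair x0 -` ?X) x1 \<partial>gauss (tau + Delta) S1)"
      by simp
    also have "\<dots> = (\<integral>\<^sup>+x1. ?I (?E x0 x1) \<partial>gauss (tau + Delta) S1)"
      by (rule nn_integral_cong) (simp add: indicator_def)
    finally show "emeasure (gauss (tau + Delta) S1) (Pair x0 -` ?X) = (\<integral>\<^sup>+x1. ?I (?E x0 x1) \<partial>gauss (tau + Delta) S1)" .
  qed
  also have "\<dots> = (\<integral>\<^sup>+x0. \<integral>\<^sup>+x1. ennreal (gauss_density tau S0 x0) * ennreal (gauss_density (tau + Delta) S1 x1) * ?I (?E x0 x1) \<partial>lborel \<partial>lborel)"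
    by (simp add: nn_integral_gauss nn_integral_cmult[symmetric] mult.assoc)
  also have "\<dots> = (\<integral>\<^sup>+x0. \<integral>\<^sup>+d. ennreal (gauss_density tau S0 x0) * ennreal (gauss_density (tau + Delta) S1 (x0 + d)) * ?I (?E x0 (x0 + d)) \<partial>lborel \<partial>lborel)"
    by (rule nn_integral_cong, rule nn_integral_lborel_plus[symmetric]) measurable
  \<comment> \<open>The order is exchanged so that, for fixed \<open>d\<close>, the first
    observation can be translated by an amount depending on \<open>d\<close>.\<close>
  also have "\<dots> = (\<integral>\<^sup>+d. \<integral>\<^sup>+x0. ennreal (gauss_density tau S0 x0) * ennreal (gauss_density (tau + Delta) S1 (x0 + d)) * ?I (?E x0 (x0 + d)) \<partial>lborel \<partial>lborel)"
    by (rule lborel_pair.Fubini'[symmetric]) measurable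
  also have "\<dots> = (\<integral>\<^sup>+d. \<integral>\<^sup>+y. ennreal (gauss_density tau S0 (tau - W *v d + y)) * ennreal (gauss_density (tau + Delta) S1 (tau - W *v d + y + d))
      * ?I (?E (tau - W *v d + y) (tau - W *v d + y + d)) \<partial>lborel \<partial>lborel)"
    by (rule nn_integral_cong, rule nn_integral_lborel_plus[symmetric]) measurable
  also have "\<dots> = (\<integral>\<^sup>+d. \<integral>\<^sup>+y. ennreal (gauss_density Delta (S0 + S1) d) * (ennreal (gauss_density (W *v Delta) (matrix_inv P) y) * ?I (y - h d)) \<partial>lborel \<partial>lborel)"
  proof (intro nn_integral_cong)
    fix d y
    have eq: "tau - W *v d + y = tau + y - W *v d" by simp
    show "ennreal (gauss_density tau S0 (tau - W *v d + y)) * ennreal (gauss_density (tau + Delta) S1 (tau - W *v d + y + d))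
      * ?I (?E (tau - W *v d + y) (tau - W *v d + y + d))
      = ennreal (gauss_density Delta (S0 + S1) d) * (ennreal (gauss_density (W *v Delta) (matrix_inv P) y) * ?I (y - h d))"
      unfolding eq E using gauss_density_precision_product[OF S0 S1, of tau y d Delta]
      unfolding P_def[symmetric] W_def[symmetric]
      by (simp add: ennreal_mult[symmetric] gauss_density_nonneg mult.assoc[symmetric] mult.commute)
  qed
  also have "\<dots> = (\<integral>\<^sup>+d. ennreal (gauss_density Delta (S0 + S1) d) * (\<integral>\<^sup>+y. ennreal (gauss_density (W *v Delta) (matrix_inv P) y) * ?I (y - h d) \<partial>lborel) \<partial>lborel)"
    by (simp add: nn_integral_cmult)
  also have "\<dots> = (\<integral>\<^sup>+u. ennreal (det S) * (ennreal (gauss_density Delta (S ** S) (S *v u)) *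
      (\<integral>\<^sup>+y. ennreal (gauss_density (W *v Delta) (matrix_inv P) y) * ?I (y - h (S *v u)) \<partial>lborel)) \<partial>lborel)"
    unfolding SS by (subst nn_integral_lborel_affine[OF S, of _ 0]) (simp_all add: nn_integral_cmult)
  also have "\<dots> = (\<integral>\<^sup>+u. ennreal (gauss_density (matrix_inv S *v Delta) (mat 1) u) *
      (\<integral>\<^sup>+y. ennreal (gauss_density (W *v Delta) (matrix_inv P) y) * ?I (y - h (S *v u)) \<partial>lborel) \<partial>lborel)"
    using det_spd_mat_pos[OF S] by (simp add: mult.assoc[symmetric] ennreal_mult[symmetric] gauss_density_nonneg gauss_density_sqrt[OF S])
  also have "\<dots> = (\<integral>\<^sup>+u. ennreal (ncchi2_cdf TYPE('n) M ((norm (B *v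
        (Delta - (if (norm u)\<^sup>2 \<le> q then 0 else S *v u))))\<^sup>2))
      * ennreal (gauss_density (matrix_inv S *v Delta) (mat 1) u) \<partial>lborel)"
  proof (rule nn_integral_cong)
    fix u
    let ?k = "B *v (if (norm u)\<^sup>2 \<le> q then 0 else S *v u)"
    have h: "h (S *v u) = R *v ?k" by (simp add: h_def matrix_inv_apply_left[OF invS] RB)
    have "(\<integral>\<^sup>+y. ennreal (gauss_density (W *v Delta) (matrix_inv P) y) * ?I (y - h (S *v u)) \<partial>lborel)
        = (\<integral>\<^sup>+v. ennreal (det R) * (ennreal (gauss_density (W *v Delta) (R ** R) (R *v v)) * ?I (R *v v - R *v ?k)) \<partial>lborel)"
      unfolding RR h by (subst nn_integral_lborel_affine[OF R, of _ 0]) (simp_all add: nn_integral_cmult)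
    also have "\<dots> = (\<integral>\<^sup>+v. ennreal (gauss_density (B *v Delta) (mat 1) v) * indicator {v. (norm (v - ?k))\<^sup>2 \<le> M} v \<partial>lborel)"
      using det_spd_mat_pos[OF R]
      by (simp add: mult.assoc[symmetric] ennreal_mult[symmetric] gauss_density_nonneg gauss_density_sqrt[OF R] RW
          matrix_vector_mult_diff_distrib[symmetric] quad indicator_def)
    also have "\<dots> = ennreal (ncchi2_cdf TYPE('n) M ((norm (B *v (Delta - (if (norm u)\<^sup>2 \<le> q then 0 else S *v u))))\<^sup>2))"
      by (simp add: emeasure_gauss_std_ball matrix_vector_mult_diff_distrib)
    finally show "ennreal (gauss_density (matrix_inv S *v Delta) (mat 1) u) *
        (\<integral>\<^sup>+y. ennreal (gauss_density (W *v Delta) (matrix_inv P) y) * ?I (y - h (S *v u)) \<partial>lborel)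
      = ennreal (ncchi2_cdf TYPE('n) M ((norm (B *v (Delta - (if (norm u)\<^sup>2 \<le> q then 0 else S *v u))))\<^sup>2))
        * ennreal (gauss_density (matrix_inv S *v Delta) (mat 1) u)"
      by (simp add: mult.commute)
  qed
  finally show ?thesis unfolding B_def .
qed

lemma ncchi2_cdf_nonneg: "0 \<le> ncchi2_cdf TYPE('n::finite) M l"
  by (simp add: ncchi2_cdf_def)

text \<open>The \<open>SOME\<close> in \<open>ncchi2_cdf\<close> hides the dependence on the
  noncentrality. Rewritten as a parameter integral of an explicit density, it is visibly measurable
  in the mean.\<close>

lemma measurable_ncchi2_cdf_norm [measurable]:
  assumes [measurable]: "f \<in> borel_measurable N"
  shows "(\<lambda>x. ncchi2_cdf TYPE('n::finite) M ((norm (f x :: real^'n))\<^sup>2)) \<in> borel_measurable N"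
proof -
  have "ncchi2_cdf TYPE('n) M ((norm m)\<^sup>2)
      = enn2real (\<integral>\<^sup>+v. ennreal (gauss_density m (mat 1) v) * indicator {v. (norm v)\<^sup>2 \<le> M} v \<partial>lborel)" for m :: "real^'n"
    using emeasure_gauss_std_ball[of m 0 M] by (simp add: ncchi2_cdf_nonneg)
  then show ?thesis by simp
qed

text \<open>The integral over u is split at the boundary of the test. On the acceptance region the
  noncentrality does not involve u, so its factor comes out and leaves the acceptance
  probability.\<close>

theorem pt_prob_formula:
  fixes S0 S1 :: "real^'n^'n" and Delta :: "real^'n"
  defines "R \<equiv> msqrt (matrix_inv (matrix_inv S0 + matrix_inv S1))" and "S \<equiv> msqrt (S0 + S1)"
  assumes S0: "spd_mat S0" and S1: "spd_mat S1"
  shows "pt_prob S0 S1 q tau Delta M =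
    ncchi2_cdf TYPE('n) M ((norm ((R ** matrix_inv S1) *v Delta))\<^sup>2)
      * ncchi2_cdf TYPE('n) q ((norm (matrix_inv S *v Delta))\<^sup>2)
    + (LINT u:{u. q < (norm u)\<^sup>2}|lborel.
        ncchi2_cdf TYPE('n) M ((norm ((R ** matrix_inv S1) *v (Delta - S *v u)))\<^sup>2)
        * gauss_density (matrix_inv S *v Delta) (mat 1) u)"
proof -
  define B where "B = R ** matrix_inv S1"
  let ?c = "\<lambda>x. ncchi2_cdf TYPE('n) M ((norm (B *v x))\<^sup>2)"
  let ?m = "matrix_inv S *v Delta"
  let ?g = "gauss_density ?m (mat 1)"
  \<comment> \<open>The \<open>u - 0\<close> gives the region the shape of
    \<open>emeasure_gauss_std_ball\<close> with centre 0.\<close>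
  let ?out = "{u. q < (norm u)\<^sup>2}" and ?in = "{u. (norm (u - 0))\<^sup>2 \<le> q}"
  have "ennreal (pt_prob S0 S1 q tau Delta M)
      = (\<integral>\<^sup>+u. ennreal (?c (Delta - (if (norm u)\<^sup>2 \<le> q then 0 else S *v u))) * ennreal (?g u) \<partial>lborel)"
    unfolding B_def R_def S_def by (rule pt_prob_emeasure[OF S0 S1])
  also have "\<dots> = (\<integral>\<^sup>+u. ennreal (?c Delta) * (ennreal (?g u) * indicator ?in u)
      + ennreal (indicator ?out u *\<^sub>R (?c (Delta - S *v u) * ?g u)) \<partial>lborel)"
    by (rule nn_integral_cong)
      (auto simp: indicator_def ennreal_mult ncchi2_cdf_nonneg gauss_density_nonneg not_le)
  also have "\<dots> = ennreal (?c Delta) * (\<integral>\<^sup>+u. ennreal (?g u) * indicator ?in u \<partial>lborel)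
      + (\<integral>\<^sup>+u. ennreal (indicator ?out u *\<^sub>R (?c (Delta - S *v u) * ?g u)) \<partial>lborel)"
    by (subst nn_integral_add) (simp_all add: nn_integral_cmult)
  also have "(\<integral>\<^sup>+u. ennreal (?g u) * indicator ?in u \<partial>lborel) = ennreal (ncchi2_cdf TYPE('n) q ((norm ?m)\<^sup>2))"
    using emeasure_gauss_std_ball[of ?m 0 q] by simp
  finally have eq: "ennreal (pt_prob S0 S1 q tau Delta M)
      = ennreal (?c Delta * ncchi2_cdf TYPE('n) q ((norm ?m)\<^sup>2))
      + (\<integral>\<^sup>+u. ennreal (indicator ?out u *\<^sub>R (?c (Delta - S *v u) * ?g u)) \<partial>lborel)"
    by (simp add: ennreal_mult ncchi2_cdf_nonneg)
  \<comment> \<open>The sum is the image of a real number, so this summand is finite and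
    \<open>enn2real\<close> is additive here.\<close>
  then have fin: "(\<integral>\<^sup>+u. ennreal (indicator ?out u *\<^sub>R (?c (Delta - S *v u) * ?g u)) \<partial>lborel) < \<top>"
    by (intro le_less_trans[OF _ ennreal_less_top[of "pt_prob S0 S1 q tau Delta M"]]) simp
  have "(LINT u:?out|lborel. ?c (Delta - S *v u) * ?g u)
      = enn2real (\<integral>\<^sup>+u. ennreal (indicator ?out u *\<^sub>R (?c (Delta - S *v u) * ?g u)) \<partial>lborel)"
    unfolding set_lebesgue_integral_def
    by (rule integral_eq_nn_integral) (auto simp: ncchi2_cdf_nonneg gauss_density_nonneg)
  moreover have "pt_prob S0 S1 q tau Delta M = enn2real (ennreal (pt_prob S0 S1 q tau Delta M))"
    by (simp add: pt_prob_def)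
  ultimately show ?thesis
    unfolding B_def[symmetric] eq using fin by (simp add: enn2real_plus ncchi2_cdf_nonneg)
qed

section \<open>Comparison of Gaussian laws under bounded shifts, null quadrics and full
  support\<close>

lemma matrix_inv_scaleR:
  fixes A :: "real^'n^'n"
  assumes "invertible A" and "c \<noteq> 0"
  shows "matrix_inv (c *\<^sub>R A) = (1 / c) *\<^sub>R matrix_inv A"
  by (rule matrix_inv_unique)
    (simp add: assms matrix_eq matrix_vector_mul_assoc[symmetric] scaleR_matrix_vector_assoc[symmetric]
      matrix_vector_mult_scaleR matrix_inv_apply_left)

lemma gauss_density_pos:
  assumes "spd_mat A"
  shows "0 < gauss_density mu A x"
  using det_spd_mat_pos[OF assms] by (simp add: gauss_density_def)

text \<open>The value of the centred density at 0 stands for the normalising constant, so the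
  determinant of the scaled matrix is never computed.\<close>

lemma gauss_density_scaleR:
  fixes A :: "real^'n^'n"
  assumes A: "spd_mat A" and c: "0 < c"
  shows "gauss_density mu (c *\<^sub>R A) x
    = gauss_density 0 (c *\<^sub>R A) 0 * exp (- ((x - mu) \<bullet> (matrix_inv A *v (x - mu))) / (2 * c))"
  using c by (simp add: gauss_density_def matrix_inv_scaleR spd_mat_invertible[OF A] scaleR_matrix_vector_assoc[symmetric])

text \<open>Halving or doubling the covariance absorbs a bounded shift of the mean, by
  \<open>|a - \<Delta>|\<^sup>2 \<le> 2|a|\<^sup>2 + 2|\<Delta>|\<^sup>2\<close> and \<open>|a - \<Delta>|\<^sup>2 \<ge> |a|\<^sup>2/2 - |\<Delta>|\<^sup>2\<close> in the precision norm.\<close>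

lemma gauss_density_shift_bounds:
  fixes A :: "real^'n^'n"
  assumes A: "spd_mat A" and K: "bounded K"
  obtains C where "0 < C"
    and "\<And>Delta x. Delta \<in> K \<Longrightarrow> gauss_density (tau + Delta) A x \<le> C * gauss_density tau (2 *\<^sub>R A) x"
    and "\<And>Delta x. Delta \<in> K \<Longrightarrow> gauss_density tau ((1/2) *\<^sub>R A) x \<le> C * gauss_density (tau + Delta) A x"
proof -
  let ?n = "\<lambda>v. v \<bullet> (matrix_inv A *v v)"
  have B: "spd_mat (matrix_inv A)" by (rule spd_mat_inv[OF A])
  obtain r where r: "\<And>x. x \<in> K \<Longrightarrow> norm x \<le> r" using K by (auto simp: bounded_iff)
  obtain N where N: "0 < N" "\<And>x. norm (matrix_inv A *v x) \<le> norm x * N"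
    using bounded_linear.pos_bounded[of "(*v) (matrix_inv A)"] by (auto simp: linear_conv_bounded_linear[symmetric])
  define k where "k = r * (r * N)"
  have k: "?n x \<le> k" if "x \<in> K" for x
  proof -
    have "?n x \<le> norm x * norm (matrix_inv A *v x)" by (rule norm_cauchy_schwarz)
    also have "\<dots> \<le> norm x * (norm x * N)" by (intro mult_left_mono N) auto
    also have "\<dots> \<le> k" unfolding k_def
      using r[OF that] N(1) by (intro mult_mono) (auto intro: order_trans[OF norm_ge_zero])
    finally show ?thesis .
  qed
  have par: "?n (a + b) + ?n (a - b) = 2 * ?n a + 2 * ?n b" for a b
    by (simp add: matrix_vector_right_distrib matrix_vector_mult_diff_distrib inner_simps)
  have up: "?n (a - b) \<le> 2 * ?n a + 2 * ?n b" for a b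
    using par[of a b] spd_mat_nonneg[OF B, of "a + b"] by simp
  have lo: "?n a \<le> 2 * ?n (a - b) + 2 * ?n b" for a b
    using par[of "a - b" b] spd_mat_nonneg[OF B, of "a - b - b"] by simp
  define c where "c s = gauss_density 0 (s *\<^sub>R A) 0" for s
  have c: "0 < c s" if "0 < s" for s unfolding c_def by (intro gauss_density_pos spd_mat_scaleR A that)
  have dens: "gauss_density mu (s *\<^sub>R A) x = c s * exp (- ?n (x - mu) / (2 * s))" if "0 < s" for s mu x
    unfolding c_def by (rule gauss_density_scaleR[OF A that])
  have dens1: "gauss_density mu A x = c 1 * exp (- ?n (x - mu) / 2)" for mu x
    using dens[of 1 mu x] by simp
  \<comment> \<open>One constant for both comparisons. Each entry is a ratio of normalising
    constants times the exponential of what the shift can contribute: k / 2 against the doubled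
    covariance and k against the halved one, with \<open>k\<close> bounding the squared precision
    norm on \<open>K\<close>.\<close>
  define C where "C = max (c 1 / c 2 * exp (k / 2)) (c (1/2) / c 1 * exp k)"
  show thesis
  proof
    show "0 < C" unfolding C_def using c by (simp add: less_max_iff_disj)
  next
    fix Delta x assume "Delta \<in> K"
    then have "c 1 * exp (- ?n (x - tau - Delta) / 2) \<le> c 1 * exp (k / 2 + - ?n (x - tau) / 4)"
      using lo[of "x - tau" Delta] k[of Delta] c[of 1] by (intro mult_left_mono) (auto simp: field_simps)
    also have "\<dots> = c 1 / c 2 * exp (k / 2) * (c 2 * exp (- ?n (x - tau) / 4))"
      unfolding exp_add using c[of 2] by simp
    also have "\<dots> \<le> C * (c 2 * exp (- ?n (x - tau) / 4))"
      unfolding C_def using c[of 2] by (intro mult_right_mono) auto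
    finally show "gauss_density (tau + Delta) A x \<le> C * gauss_density tau (2 *\<^sub>R A) x"
      by (simp add: dens dens1 diff_diff_eq)
  next
    fix Delta x assume "Delta \<in> K"
    then have "c (1/2) * exp (- ?n (x - tau)) \<le> c (1/2) * exp (k + - ?n (x - tau - Delta) / 2)"
      using up[of "x - tau" Delta] k[of Delta] c[of "1/2"] by (intro mult_left_mono) (auto simp: field_simps)
    also have "\<dots> = c (1/2) / c 1 * exp k * (c 1 * exp (- ?n (x - tau - Delta) / 2))"
      unfolding exp_add using c[of 1] by simp
    also have "\<dots> \<le> C * (c 1 * exp (- ?n (x - tau - Delta) / 2))"
      unfolding C_def using c[of 1] by (intro mult_right_mono) auto
    finally show "gauss_density tau ((1/2) *\<^sub>R A) x \<le> C * gauss_density (tau + Delta) A x"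
      by (simp add: dens dens1 diff_diff_eq)
  qed
qed

text \<open>Lifts a pointwise comparison of densities of the second observation to events in both
  observations. It serves for the upper and for the lower comparison.\<close>

lemma measure_gauss_pair_mono:
  fixes S0 A A' :: "real^'n^'n"
  assumes spd: "spd_mat S0" "spd_mat A" "spd_mat A'" and C: "0 \<le> C"
    and le: "\<And>x. gauss_density m A x \<le> C * gauss_density m' A' x"
    and X: "X \<in> sets (borel \<Otimes>\<^sub>M borel)"
  shows "measure (gauss t S0 \<Otimes>\<^sub>M gauss m A) X \<le> C * measure (gauss t S0 \<Otimes>\<^sub>M gauss m' A') X"
proof -
  interpret g0: prob_space "gauss t S0" by (rule prob_space_gauss[OF spd(1)])
  interpret g1: prob_space "gauss m A" by (rule prob_space_gauss[OF spd(2)])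
  interpret g2: prob_space "gauss m' A'" by (rule prob_space_gauss[OF spd(3)])
  interpret p1: pair_prob_space "gauss t S0" "gauss m A" ..
  interpret p2: pair_prob_space "gauss t S0" "gauss m' A'" ..
  have sets: "sets (gauss t S0 \<Otimes>\<^sub>M gauss m A) = sets (borel \<Otimes>\<^sub>M borel)" "sets (gauss t S0 \<Otimes>\<^sub>M gauss m' A') = sets (borel \<Otimes>\<^sub>M borel)"
    by (auto intro!: sets_pair_measure_cong)
  have "emeasure (gauss t S0 \<Otimes>\<^sub>M gauss m A) X = (\<integral>\<^sup>+x. emeasure (gauss m A) (Pair x -` X) \<partial>gauss t S0)"
    using X by (intro g1.emeasure_pair_measure_alt) (simp add: sets)
  also have "\<dots> \<le> (\<integral>\<^sup>+x. ennreal C * emeasure (gauss m' A') (Pair x -` X) \<partial>gauss t S0)"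
  proof (rule nn_integral_mono)
    fix x
    have [measurable]: "Pair x -` X \<in> sets borel" by (rule sets_Pair1[OF X])
    have "emeasure (gauss m A) (Pair x -` X) \<le> (\<integral>\<^sup>+y. ennreal C * (ennreal (gauss_density m' A' y) * indicator (Pair x -` X) y) \<partial>lborel)"
      unfolding emeasure_gauss[OF \<open>Pair x -` X \<in> sets borel\<close>]
      using le C by (intro nn_integral_mono) (auto simp: indicator_def ennreal_mult[symmetric] gauss_density_nonneg intro: ennreal_leI)
    also have "\<dots> = ennreal C * emeasure (gauss m' A') (Pair x -` X)"
      by (simp add: emeasure_gauss nn_integral_cmult)
    finally show "emeasure (gauss m A) (Pair x -` X) \<le> ennreal C * emeasure (gauss m' A') (Pair x -` X)" .
  qed
  also have "\<dots> = ennreal C * (\<integral>\<^sup>+x. emeasure (gauss m' A') (Pair x -` X) \<partial>gauss t S0)"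
    using X by (intro nn_integral_cmult g2.measurable_emeasure_Pair) (simp add: sets)
  also have "\<dots> = ennreal C * emeasure (gauss t S0 \<Otimes>\<^sub>M gauss m' A') X"
    using X by (subst g2.emeasure_pair_measure_alt) (simp_all add: sets)
  finally show ?thesis
    using C by (simp add: p1.P.emeasure_eq_measure p2.P.emeasure_eq_measure ennreal_mult[symmetric])
qed

lemma emeasure_gauss_open_pos:
  assumes A: "spd_mat A" and V: "open V" "V \<noteq> {}"
  shows "0 < emeasure (gauss mu A) V"
proof (rule ccontr)
  assume "\<not> ?thesis"
  then have "(\<integral>\<^sup>+x. ennreal (gauss_density mu A x) * indicator V x \<partial>lborel) = 0"
    using V(1) by (simp add: emeasure_gauss)
  then have "AE x in lborel. ennreal (gauss_density mu A x) * indicator V x = 0"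
    using V(1) by (subst (asm) nn_integral_0_iff_AE) auto
  then have "AE x in lborel. x \<notin> V"
    by eventually_elim (auto simp: indicator_def ennreal_eq_0_iff gauss_density_pos[OF A, unfolded not_le[symmetric]])
  then have "V \<in> null_sets lborel"
    using V(1) by (subst AE_iff_null_sets) auto
  then have "negligible V" by (simp add: negligible_iff_null_sets null_sets_completionI)
  then show False using open_not_negligible[OF V] by simp
qed

text \<open>The root of \<open>P\<close> turns the level set into the preimage of a sphere under an
  invertible affine map, and spheres are negligible.\<close>

lemma AE_gauss_quadric:
  fixes P W :: "real^'n^'n"
  assumes P: "spd_mat P" and W: "invertible W"
  shows "AE x in gauss mu A. (b + W *v x) \<bullet> (P *v (b + W *v x)) \<noteq> M"
proof -
  let ?S = "msqrt P"
  let ?X = "{y. (norm (?S *v b + y))\<^sup>2 = M}"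
  have S: "spd_mat ?S" and SS: "?S ** ?S = P" by (simp_all add: P spd_mat_msqrt msqrt_mult_msqrt)
  have quad: "y \<bullet> (P *v y) = (norm (?S *v y))\<^sup>2" for y
    by (simp add: power2_norm_eq_inner spd_mat_inner[OF S] matrix_vector_mul_assoc SS)
  have X: "?X \<in> sets borel" by measurable
  have "?X \<subseteq> sphere (- (?S *v b)) (sqrt M)"
    by (auto simp: dist_norm add.commute norm_minus_commute)
  then have "negligible ?X" by (rule negligible_subset[OF negligible_sphere])
  then have "?X \<in> null_sets lborel"
    using X by (simp add: negligible_iff_null_sets null_sets_completion_iff)
  then have "(\<integral>\<^sup>+x. indicator ?X x \<partial>lborel) = 0" using X by (simp add: null_setsD1)
  moreover have det: "det (?S ** W) \<noteq> 0"
    using W det_spd_mat_pos[OF S] by (simp add: det_mul invertible_det_nz)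
  ultimately have "(\<integral>\<^sup>+x. indicator ?X ((?S ** W) *v x) \<partial>lborel) = (0::ennreal)"
    using X by (subst (asm) nn_integral_lborel_matrix[OF det]) auto
  then have "AE x in lborel. indicator ?X ((?S ** W) *v x) = (0::ennreal)"
    by (subst (asm) nn_integral_0_iff_AE) (use X in measurable)
  then have "AE x in lborel. (norm (?S *v (b + W *v x)))\<^sup>2 \<noteq> M"
    by eventually_elim (auto simp: matrix_vector_right_distrib matrix_vector_mul_assoc split: split_indicator_asm)
  then show ?thesis
    unfolding gauss_def quad by (subst AE_density) auto
qed

subsection \<open>The quantile equation\<close>

text \<open>The increments of every \<open>p d\<close> are dominated by those of one continuous function \<open>H\<close> and bounded
  below by a positive \<open>g\<close>, both independent of \<open>d\<close>; so the infimum inherits continuity and strict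
  monotonicity, although it need not be attained.\<close>

lemma INF_cdf_quantile:
  fixes p :: "'d \<Rightarrow> real \<Rightarrow> real" and H :: "real \<Rightarrow> real" and g :: "real \<Rightarrow> real \<Rightarrow> real"
  assumes K: "K \<noteq> {}"
    and nonneg: "\<And>d M. 0 \<le> p d M"
    and neg: "\<And>d M. M < 0 \<Longrightarrow> p d M = 0"
    and upper: "\<And>d M M'. d \<in> K \<Longrightarrow> M \<le> M' \<Longrightarrow> p d M' \<le> p d M + (H M' - H M)"
    and tail: "\<And>d M. d \<in> K \<Longrightarrow> 1 - p d M \<le> L - H M"
    and H: "\<And>M. isCont H M" "(H \<longlongrightarrow> L) at_top"
    and lower: "\<And>d M M'. d \<in> K \<Longrightarrow> 0 \<le> M \<Longrightarrow> M < M' \<Longrightarrow> p d M + g M M' \<le> p d M'"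
    and g: "\<And>M M'. 0 \<le> M \<Longrightarrow> M < M' \<Longrightarrow> 0 < g M M'"
    and a: "0 < a" "a < 1"
  defines "F \<equiv> \<lambda>M. INF d\<in>K. p d M"
  shows "F M = a \<longleftrightarrow> M = Inf {M. 0 \<le> M \<and> a \<le> F M}"
proof -
  have bdd: "bdd_below ((\<lambda>d. p d M) ` K)" for M
    using nonneg by (intro bdd_belowI2)
  have F_le: "F M \<le> p d M" if "d \<in> K" for d M
    unfolding F_def by (rule cINF_lower[OF bdd that])
  have F_ge: "x \<le> F M" if "\<And>d. d \<in> K \<Longrightarrow> x \<le> p d M" for x M
    unfolding F_def by (rule cINF_greatest[OF K that])
  have F_neg: "F M = 0" if "M < 0" for M
    unfolding F_def using neg[OF that] K by simp
  have F_strict: "F M < F M'" if "0 \<le> M" "M < M'" for M M'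
  proof -
    have "F M + g M M' \<le> F M'"
      using F_le lower[OF _ that] by (intro F_ge) (meson add_right_mono order_trans)
    then show ?thesis using g[OF that] by simp
  qed
  have F_mono: "F M \<le> F M'" if "M \<le> M'" for M M'
  proof (cases "M < 0")
    case True
    then show ?thesis using F_ge[of 0 M'] nonneg by (simp add: F_neg)
  next
    case False
    then show ?thesis using F_strict[of M M'] that by (cases "M = M'") auto
  qed
  have F_upper: "F M' - F M \<le> H M' - H M" if "M \<le> M'" for M M'
  proof -
    have "F M' - (H M' - H M) \<le> F M"
    proof (rule F_ge)
      fix d assume d: "d \<in> K"
      show "F M' - (H M' - H M) \<le> p d M" using F_le[OF d, of M'] upper[OF d that] by linarith
    qed
    then show ?thesis by simp
  qed
  have F_dist: "\<bar>F y - F x\<bar> \<le> \<bar>H y - H x\<bar>" for x y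
  proof (cases "x \<le> y")
    case True
    then show ?thesis using F_upper[of x y] F_mono[of x y] by linarith
  next
    case False
    then show ?thesis using F_upper[of y x] F_mono[of y x] by linarith
  qed
  have contF: "isCont F x" for x
  proof -
    have "((\<lambda>y. H y - H x) \<longlongrightarrow> 0) (at x)"
      using H(1)[of x] by (simp add: isCont_def LIM_zero_iff)
    then have "((\<lambda>y. F y - F x) \<longlongrightarrow> 0) (at x)"
      by (rule Lim_null_comparison[rotated, OF tendsto_rabs_zero]) (simp add: F_dist)
    then show ?thesis by (simp add: isCont_def LIM_zero_iff)
  qed
  \<comment> \<open>By \<open>tail\<close>, \<open>H B\<close> within 1 - a of its limit forces p d
    B above a for all d in K at once.\<close>
  have "\<forall>\<^sub>F M in at_top. L - (1 - a) < H M"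
    using H(2) a by (intro order_tendstoD(1)) auto
  then have "\<forall>\<^sub>F M in at_top. L - (1 - a) < H M \<and> 0 \<le> M"
    using eventually_ge_at_top[of 0] by eventually_elim simp
  then obtain B where B: "L - (1 - a) < H B" "0 \<le> B"
    using eventually_happens[of _ "at_top :: real filter"] by auto
  have "a \<le> F B"
  proof (rule F_ge)
    fix d assume "d \<in> K"
    then show "a \<le> p d B" using tail[of d B] B(1) by linarith
  qed
  \<comment> \<open>The interval starts at -1 because F is known there: it is 0, hence below
    a.\<close>
  then obtain m where m: "F m = a"
    using IVT[of F "-1" a B] contF B(2) a(1) F_neg[of "-1"] by auto
  then have m0: "0 \<le> m" using F_neg[of m] a(1) by force
  have eq: "F M = a \<longleftrightarrow> M = m" for M
  proof
    assume M: "F M = a"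
    then have "0 \<le> M" using F_neg[of M] a(1) by force
    then show "M = m" using F_strict[of M m] F_strict[of m M] m m0 M by linarith
  qed (simp add: m)
  \<comment> \<open>Strict monotonicity makes the superlevel set a closed half-line, so its infimum
    is the solution itself.\<close>
  have "{M. 0 \<le> M \<and> a \<le> F M} = {m..}"
  proof (intro set_eqI)
    fix M
    show "M \<in> {M. 0 \<le> M \<and> a \<le> F M} \<longleftrightarrow> M \<in> {m..}"
      using F_strict[of M m] F_mono[of m M] m m0 by force
  qed
  then show ?thesis using eq by simp
qed

section \<open>The loss as a random variable, and its worst-case distribution function\<close>

text \<open>The bias is no argument: it enters \<open>pt_prob\<close> through the measure only, so
  events of the loss can be compared across biases.\<close>

definition pt_loss :: "real^'n^'n \<Rightarrow> real^'n^'n \<Rightarrow> real \<Rightarrow> real^'n \<Rightarrow> (real^'n) \<times> (real^'n) \<Rightarrow> real" where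
  "pt_loss S0 S1 q tau p = (let e = pt_est S0 S1 q (fst p) (snd p) - tau
     in e \<bullet> ((matrix_inv S0 + matrix_inv S1) *v e))"

lemma pt_prob_pt_loss:
  "pt_prob S0 S1 q tau Delta M
    = measure (gauss tau S0 \<Otimes>\<^sub>M gauss (tau + Delta) S1) {p. pt_loss S0 S1 q tau p \<le> M}"
  by (simp add: pt_prob_def pt_loss_def Let_def)

lemma measurable_pt_loss [measurable]:
  "pt_loss S0 S1 q tau \<in> borel_measurable (borel \<Otimes>\<^sub>M borel)"
  unfolding pt_loss_def[abs_def] pt_est_def Let_def by measurable

lemma pt_loss_nonneg:
  assumes "spd_mat S0" "spd_mat S1"
  shows "0 \<le> pt_loss S0 S1 q tau p"
  unfolding pt_loss_def Let_def by (intro spd_mat_nonneg spd_mat_add spd_mat_inv assms)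

text \<open>Whatever the test decides, the error is either x0 - tau or the pooled error, which for
  fixed x0 is affine in x1 with invertible linear part. Excluding the quadric for both expressions
  avoids any discussion of the test boundary.\<close>

lemma AE_pt_loss_neq:
  fixes S0 S1 A :: "real^'n^'n"
  assumes S0: "spd_mat S0" and S1: "spd_mat S1" and A: "spd_mat A"
  shows "AE p in gauss tau S0 \<Otimes>\<^sub>M gauss mu A. pt_loss S0 S1 q tau p \<noteq> M"
proof -
  interpret g0: prob_space "gauss tau S0" by (rule prob_space_gauss[OF S0])
  interpret g1: prob_space "gauss mu A" by (rule prob_space_gauss[OF A])
  interpret g: pair_prob_space "gauss tau S0" "gauss mu A" ..
  let ?P = "matrix_inv S0 + matrix_inv S1"
  let ?W = "matrix_inv ?P ** matrix_inv S1"
  have P: "spd_mat ?P" using S0 S1 by (intro spd_mat_add spd_mat_inv)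
  have W: "invertible ?W"
    using spd_mat_invertible[OF spd_mat_inv[OF P]] spd_mat_invertible[OF spd_mat_inv[OF S1]] by (rule invertible_mult)
  show ?thesis
  proof (rule g.AE_pair_measure)
    have "{x \<in> space (gauss tau S0 \<Otimes>\<^sub>M gauss mu A). pt_loss S0 S1 q tau x \<noteq> M}
        = {x \<in> space (borel \<Otimes>\<^sub>M borel). pt_loss S0 S1 q tau x \<noteq> M}"
      by (simp add: space_pair_measure)
    also have "\<dots> \<in> sets (borel \<Otimes>\<^sub>M borel)" by measurable
    also have "sets (borel \<Otimes>\<^sub>M borel) = sets (gauss tau S0 \<Otimes>\<^sub>M gauss mu A)"
      by (rule sets_pair_measure_cong) simp_all
    finally show "{x \<in> space (gauss tau S0 \<Otimes>\<^sub>M gauss mu A). pt_loss S0 S1 q tau x \<noteq> M} \<in> sets (gauss tau S0 \<Otimes>\<^sub>M gauss mu A)" .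
  next
    have "AE x0 in gauss tau S0. (- tau + mat 1 *v x0) \<bullet> (?P *v (- tau + mat 1 *v x0)) \<noteq> M"
      by (rule AE_gauss_quadric[OF P]) (simp add: invertible_def exI[of _ "mat 1"])
    then show "AE x0 in gauss tau S0. AE x1 in gauss mu A. pt_loss S0 S1 q tau (x0, x1) \<noteq> M"
    proof eventually_elim
      fix x0 assume x0: "(- tau + mat 1 *v x0) \<bullet> (?P *v (- tau + mat 1 *v x0)) \<noteq> M"
      have "AE x1 in gauss mu A. ((x0 - tau - ?W *v x0) + ?W *v x1) \<bullet> (?P *v ((x0 - tau - ?W *v x0) + ?W *v x1)) \<noteq> M"
        by (rule AE_gauss_quadric[OF P W])
      then show "AE x1 in gauss mu A. pt_loss S0 S1 q tau (x0, x1) \<noteq> M"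
      proof eventually_elim
        fix x1 assume x1: "((x0 - tau - ?W *v x0) + ?W *v x1) \<bullet> (?P *v ((x0 - tau - ?W *v x0) + ?W *v x1)) \<noteq> M"
        have "pt_est S0 S1 q x0 x1 - tau = (x0 - tau - ?W *v x0) + ?W *v x1
            \<or> pt_est S0 S1 q x0 x1 - tau = - tau + mat 1 *v x0"
          by (simp add: pt_est_def matrix_vector_mult_diff_distrib)
        then show "pt_loss S0 S1 q tau (x0, x1) \<noteq> M"
          using x0 x1 unfolding pt_loss_def Let_def fst_conv snd_conv by metis
      qed
    qed
  qed
qed

text \<open>On rejection the loss depends on x0 alone. So x0 can be placed inside the shell and x1
  chosen far enough away to be rejected, and a neighbourhood of this point has positive
  mass.\<close>

lemma pt_loss_shell_pos:
  fixes S0 S1 A :: "real^'n^'n"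
  assumes S0: "spd_mat S0" and S1: "spd_mat S1" and A: "spd_mat A" and q: "0 \<le> q" and M: "0 \<le> M" "M < M'"
  shows "0 < measure (gauss tau S0 \<Otimes>\<^sub>M gauss mu A) {p. M < pt_loss S0 S1 q tau p \<and> pt_loss S0 S1 q tau p \<le> M'}"
    (is "0 < measure ?N ?X")
proof -
  interpret g0: prob_space "gauss tau S0" by (rule prob_space_gauss[OF S0])
  interpret g1: prob_space "gauss mu A" by (rule prob_space_gauss[OF A])
  interpret g: pair_prob_space "gauss tau S0" "gauss mu A" ..
  let ?P = "matrix_inv S0 + matrix_inv S1"
  let ?S = "msqrt (S0 + S1)"
  let ?Q = "\<lambda>x. (x - tau) \<bullet> (?P *v (x - tau))"
  have P: "spd_mat ?P" using S0 S1 by (intro spd_mat_add spd_mat_inv)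
  have S: "invertible ?S" by (intro spd_mat_invertible spd_mat_msqrt spd_mat_add S0 S1)
  \<comment> \<open>All inequalities are strict, which makes \<open>U\<close> open although the
    shell is half-open.\<close>
  define U where "U = {p. M < ?Q (fst p) \<and> ?Q (fst p) < M' \<and> q < (norm (matrix_inv ?S *v (snd p - fst p)))\<^sup>2}"
  have cont: "continuous_on UNIV (\<lambda>p. B *v f p)" if "continuous_on UNIV f" for B :: "real^'n^'n" and f :: "(real^'n) \<times> (real^'n) \<Rightarrow> real^'n"
    by (rule continuous_on_compose2[OF _ that, of UNIV])
      (auto intro!: linear_continuous_on simp: linear_conv_bounded_linear[symmetric])
  have "open U" unfolding U_def
    by (intro open_Collect_conj open_Collect_less continuous_intros cont)
  obtain e :: "real^'n" where e: "norm e = 1" using norm_axis_1 by blast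
  define a where "a = e \<bullet> (?P *v e)"
  have a: "0 < a" using P e unfolding a_def spd_mat_def by (metis norm_zero zero_neq_one)
  \<comment> \<open>The scaling puts the loss at the midpoint of M and M', as \<open>a\<close> is
    the quadratic form at \<open>e\<close>.\<close>
  define x0 where "x0 = tau + sqrt ((M + M') / 2 / a) *\<^sub>R e"
  \<comment> \<open>The squared test statistic becomes q + 1, which exceeds the threshold.\<close>
  define x1 where "x1 = x0 + ?S *v (sqrt (q + 1) *\<^sub>R e)"
  have "?Q x0 = (M + M') / 2"
    using a M by (simp add: x0_def matrix_vector_mult_scaleR a_def[symmetric] mult.assoc[symmetric])
  moreover have "(norm (matrix_inv ?S *v (x1 - x0)))\<^sup>2 = q + 1"
    using q e by (simp add: x1_def matrix_inv_apply_left[OF S])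
  ultimately have "(x0, x1) \<in> U" using M by (simp add: U_def)
  then obtain V V' where V: "open V" "x0 \<in> V" "open V'" "x1 \<in> V'" "V \<times> V' \<subseteq> U"
    using \<open>open U\<close> by (auto elim!: open_prod_elim)
  have UX: "U \<subseteq> ?X"
    by (auto simp: U_def pt_loss_def pt_est_def Let_def)
  have "?X = {p \<in> space (borel \<Otimes>\<^sub>M borel). M < pt_loss S0 S1 q tau p \<and> pt_loss S0 S1 q tau p \<le> M'}"
    by (simp add: space_pair_measure)
  also have "\<dots> \<in> sets (borel \<Otimes>\<^sub>M borel)" by measurable
  also have "sets (borel \<Otimes>\<^sub>M borel) = sets ?N"
    by (rule sets_pair_measure_cong) simp_all
  finally have X: "?X \<in> sets ?N" .
  have "0 < emeasure (gauss tau S0) V * emeasure (gauss mu A) V'"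
    using emeasure_gauss_open_pos[OF S0 V(1), of tau] emeasure_gauss_open_pos[OF A V(3), of mu] V
    by (auto simp: ennreal_zero_less_mult_iff)
  also have "\<dots> = emeasure ?N (V \<times> V')"
    using V by (intro g1.emeasure_pair_measure_Times[symmetric]) auto
  also have "\<dots> \<le> emeasure ?N ?X"
    using V(5) UX X by (intro emeasure_mono) auto
  finally show ?thesis by (simp add: g.P.emeasure_eq_measure)
qed

lemma bounded_matrix_inv_box:
  fixes S :: "real^'n^'n"
  assumes S: "spd_mat S"
  shows "bounded {x. \<forall>j. \<bar>(matrix_inv S *v x) $ j\<bar> \<le> b $ j}"
proof -
  obtain N where N: "0 < N" "\<And>x. norm (S *v x) \<le> norm x * N"
    using bounded_linear.pos_bounded[of "(*v) S"] by (auto simp: linear_conv_bounded_linear[symmetric])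
  have "norm x \<le> (\<Sum>j\<in>UNIV. b $ j) * N" if "\<forall>j. \<bar>(matrix_inv S *v x) $ j\<bar> \<le> b $ j" for x
  proof -
    have "norm x = norm (S *v (matrix_inv S *v x))"
      by (simp add: matrix_inv_apply_right[OF spd_mat_invertible[OF S]])
    also have "\<dots> \<le> norm (matrix_inv S *v x) * N" by (rule N)
    also have "\<dots> \<le> (\<Sum>j\<in>UNIV. b $ j) * N"
      using that N(1) by (intro mult_right_mono order_trans[OF norm_le_l1_cart] sum_mono) auto
    finally show ?thesis .
  qed
  then show ?thesis unfolding bounded_iff by blast
qed

text \<open>Boundedness of \<open>K\<close> is what yields a single constant \<open>C\<close>.
  Doubling the covariance of the second observation gives a law that dominates all biases in
  \<open>K\<close>, and halving it gives one dominated by all of them.\<close>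

theorem INF_pt_prob_quantile:
  fixes S0 S1 :: "real^'n^'n" and tau :: "real^'n" and q :: real
  assumes S0: "spd_mat S0" and S1: "spd_mat S1" and q: "0 \<le> q" and K: "bounded K" "K \<noteq> {}" and a: "0 < a" "a < 1"
  defines "F \<equiv> \<lambda>M. INF Delta\<in>K. pt_prob S0 S1 q tau Delta M"
  shows "F M = a \<longleftrightarrow> M = Inf {M. 0 \<le> M \<and> a \<le> F M}"
proof -
  let ?l = "pt_loss S0 S1 q tau"
  let ?N = "\<lambda>D. gauss tau S0 \<Otimes>\<^sub>M gauss (tau + D) S1"
  let ?lo = "gauss tau S0 \<Otimes>\<^sub>M gauss tau ((1/2) *\<^sub>R S1)" and ?hi = "gauss tau S0 \<Otimes>\<^sub>M gauss tau (2 *\<^sub>R S1)"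
  have S1lo: "spd_mat ((1/2) *\<^sub>R S1)" and S1hi: "spd_mat (2 *\<^sub>R S1)" using S1 by (auto intro!: spd_mat_scaleR)
  obtain C where C: "0 < C"
    and up: "\<And>Delta x. Delta \<in> K \<Longrightarrow> gauss_density (tau + Delta) S1 x \<le> C * gauss_density tau (2 *\<^sub>R S1) x"
    and lo: "\<And>Delta x. Delta \<in> K \<Longrightarrow> gauss_density tau ((1/2) *\<^sub>R S1) x \<le> C * gauss_density (tau + Delta) S1 x"
    by (rule gauss_density_shift_bounds[OF S1 K(1), of tau]) blast
  have sets: "sets (gauss tau S0 \<Otimes>\<^sub>M gauss m B) = sets (borel \<Otimes>\<^sub>M borel)" for m and B :: "real^'n^'n"
    by (rule sets_pair_measure_cong) simp_all
  have meas: "{p. Q (?l p)} \<in> sets (borel \<Otimes>\<^sub>M borel)" if "Measurable.pred borel Q" for Q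
  proof -
    have "{p \<in> space (borel \<Otimes>\<^sub>M borel). Q (?l p)} \<in> sets (borel \<Otimes>\<^sub>M borel)"
      using that by measurable
    then show ?thesis by (simp add: space_pair_measure)
  qed
  have ps: "prob_space (gauss tau S0 \<Otimes>\<^sub>M gauss m B)" if "spd_mat B" for m and B :: "real^'n^'n"
  proof -
    interpret g0: prob_space "gauss tau S0" by (rule prob_space_gauss[OF S0])
    interpret g1: prob_space "gauss m B" by (rule prob_space_gauss[OF that])
    interpret g: pair_prob_space "gauss tau S0" "gauss m B" ..
    show ?thesis by (rule g.P.prob_space_axioms)
  qed
  interpret hi: prob_space ?hi by (rule ps[OF S1hi])
  have lM: "?l \<in> borel_measurable ?hi"
    using measurable_pt_loss by (simp cong: measurable_cong_sets add: sets)
  interpret cdf: real_distribution "distr ?hi borel ?l" by (rule hi.real_distribution_distr[OF lM])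
  have cdf: "cdf (distr ?hi borel ?l) M = measure ?hi {p. ?l p \<le> M}" for M
    using lM by (simp add: cdf_def measure_distr vimage_def space_pair_measure)
  \<comment> \<open>\<open>H\<close> is a distribution function scaled by \<open>C\<close>, so its
    limit at infinity is \<open>C\<close> rather than 1. \<open>g\<close> is the shell mass under
    the dominated law, with the comparison constant divided out.\<close>
  define H where "H M = C * measure ?hi {p. ?l p \<le> M}" for M
  define g where "g M M' = measure ?lo {p. M < ?l p \<and> ?l p \<le> M'} / C" for M M'
  have incr: "pt_prob S0 S1 q tau D M' = pt_prob S0 S1 q tau D M + measure (?N D) {p. M < ?l p \<and> ?l p \<le> M'}"
    if "M \<le> M'" for D M M'
  proof -
    interpret prob_space "?N D" by (rule ps[OF S1])
    have "{p. ?l p \<le> M'} = {p. ?l p \<le> M} \<union> {p. M < ?l p \<and> ?l p \<le> M'}" using that by auto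
    then show ?thesis
      unfolding pt_prob_pt_loss by (simp only:) (rule finite_measure_Union, auto simp: sets intro!: meas)
  qed
  have incr_hi: "measure ?hi {p. M < ?l p \<and> ?l p \<le> M'} = measure ?hi {p. ?l p \<le> M'} - measure ?hi {p. ?l p \<le> M}"
    if "M \<le> M'" for M M'
  proof -
    have "{p. ?l p \<le> M'} = {p. ?l p \<le> M} \<union> {p. M < ?l p \<and> ?l p \<le> M'}" using that by auto
    moreover have "measure ?hi ({p. ?l p \<le> M} \<union> {p. M < ?l p \<and> ?l p \<le> M'})
        = measure ?hi {p. ?l p \<le> M} + measure ?hi {p. M < ?l p \<and> ?l p \<le> M'}"
      by (rule hi.finite_measure_Union) (auto simp: sets intro!: meas)
    ultimately show ?thesis by simp
  qed
  show ?thesis unfolding F_def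
  proof (rule INF_cdf_quantile[where H=H and L=C and g=g])
    fix D M
    show "0 \<le> pt_prob S0 S1 q tau D M" by (simp add: pt_prob_def)
    show "pt_prob S0 S1 q tau D M = 0" if "M < 0"
    proof -
      have "{p. ?l p \<le> M} = {}" using pt_loss_nonneg[OF S0 S1, of q tau] that by (auto simp: not_le intro: less_le_trans)
      then show ?thesis unfolding pt_prob_pt_loss by (simp only: measure_empty)
    qed
  next
    fix D M M' assume D: "D \<in> K" and M: "M \<le> (M'::real)"
    have "measure (?N D) {p. M < ?l p \<and> ?l p \<le> M'} \<le> C * measure ?hi {p. M < ?l p \<and> ?l p \<le> M'}"
      by (rule measure_gauss_pair_mono[OF S0 S1 S1hi _ up[OF D]]) (use C in \<open>auto intro!: meas\<close>)
    then show "pt_prob S0 S1 q tau D M' \<le> pt_prob S0 S1 q tau D M + (H M' - H M)"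
      unfolding incr[OF M] incr_hi[OF M] H_def by (simp add: right_diff_distrib)
  next
    fix D M assume D: "D \<in> K"
    interpret N: prob_space "?N D" by (rule ps[OF S1])
    have sp: "space (?N D) - {p. ?l p \<le> M} = {p. M < ?l p}" "space ?hi - {p. ?l p \<le> M} = {p. M < ?l p}"
      by (auto simp: space_pair_measure)
    have "measure (?N D) {p. M < ?l p} \<le> C * measure ?hi {p. M < ?l p}"
      by (rule measure_gauss_pair_mono[OF S0 S1 S1hi _ up[OF D]]) (use C in \<open>auto intro!: meas\<close>)
    moreover have "measure (?N D) {p. M < ?l p} = 1 - measure (?N D) {p. ?l p \<le> M}"
      unfolding sp(1)[symmetric] by (rule N.prob_compl) (auto simp: sets intro!: meas)
    moreover have "measure ?hi {p. M < ?l p} = 1 - measure ?hi {p. ?l p \<le> M}"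
      unfolding sp(2)[symmetric] by (rule hi.prob_compl) (auto simp: sets intro!: meas)
    ultimately show "1 - pt_prob S0 S1 q tau D M \<le> C - H M"
      unfolding pt_prob_pt_loss H_def by (simp add: right_diff_distrib)
  next
    fix M
    have "measure ?hi {p. ?l p = M} = 0"
    proof -
      have "AE p in ?hi. p \<notin> {p. ?l p = M}" using AE_pt_loss_neq[OF S0 S1 S1hi, where tau=tau and mu=tau and q=q and M=M] by simp
      then have "{p. ?l p = M} \<in> null_sets ?hi"
        by (subst AE_iff_null_sets) (auto simp: sets intro!: meas)
      then show ?thesis by (simp add: measure_eq_0_null_sets)
    qed
    then have "measure (distr ?hi borel ?l) {M} = 0"
      using lM by (simp add: measure_distr vimage_def space_pair_measure)
    \<comment> \<open>A distribution function is continuous exactly where its law has no atom, and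
      level sets of the loss are null.\<close>
    then have "isCont (cdf (distr ?hi borel ?l)) M" by (simp add: cdf.isCont_cdf)
    then show "isCont H M" unfolding H_def cdf[symmetric] by (intro continuous_intros)
  next
    have "((\<lambda>M. C * cdf (distr ?hi borel ?l) M) \<longlongrightarrow> C * 1) at_top"
      by (intro tendsto_intros cdf.cdf_lim_at_top_prob)
    then show "(H \<longlongrightarrow> C) at_top" unfolding H_def cdf by simp
  next
    fix D M M' assume D: "D \<in> K" and M: "0 \<le> M" "M < (M'::real)"
    have "measure ?lo {p. M < ?l p \<and> ?l p \<le> M'} \<le> C * measure (?N D) {p. M < ?l p \<and> ?l p \<le> M'}"
      by (rule measure_gauss_pair_mono[OF S0 S1lo S1 _ lo[OF D]]) (use C in \<open>auto intro!: meas\<close>)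
    then show "pt_prob S0 S1 q tau D M + g M M' \<le> pt_prob S0 S1 q tau D M'"
      using C incr[of M M' D] M by (simp add: g_def field_simps)
  next
    fix M M' :: real assume "0 \<le> M" "M < M'"
    then show "0 < g M M'"
      unfolding g_def using C by (intro divide_pos_pos pt_loss_shell_pos S0 S1 S1lo q)
  qed (use K a in auto)
qed

theorem theorem5:
  fixes Sig0 Sig1 Sig :: "real^'n^'n" and tau b :: "real^'n" and zeta q :: real
  assumes "spd_mat Sig0" and "spd_mat Sig1" and "spd_mat Sig"
    and "\<forall>j. 0 \<le> b $ j"
    and "0 < zeta" and "zeta < 1" and "0 \<le> q"
  shows
    "(\<forall>t M. 0 \<le> M \<longrightarrow>
        pt_prob Sig0 Sig1 q tau (msqrt Sig *v t) M =
          ncchi2_cdf TYPE('n) M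
            ((norm ((msqrt (matrix_inv (matrix_inv Sig0 + matrix_inv Sig1)) ** matrix_inv Sig1 ** msqrt Sig) *v t)) ^ 2)
          * ncchi2_cdf TYPE('n) q
            ((norm ((matrix_inv (msqrt (Sig0 + Sig1)) ** msqrt Sig) *v t)) ^ 2)
          + (LINT u:{u. q < (norm u) ^ 2}|lborel.
              ncchi2_cdf TYPE('n) M
                ((norm ((msqrt (matrix_inv (matrix_inv Sig0 + matrix_inv Sig1)) ** matrix_inv Sig1) *v
                        (msqrt Sig *v t - msqrt (Sig0 + Sig1) *v u))) ^ 2)
              * gauss_density ((matrix_inv (msqrt (Sig0 + Sig1)) ** msqrt Sig) *v t) (mat 1) u))
     \<and>
     (let F = (\<lambda>M. INF Delta\<in>{Delta. \<forall>j. \<bar>(matrix_inv (msqrt Sig) *v Delta) $ j\<bar> \<le> b $ j}.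
                      pt_prob Sig0 Sig1 q tau Delta M);
          Mhat = Inf {M. 0 \<le> M \<and> 1 - zeta \<le> F M}
      in \<forall>M. F M = 1 - zeta \<longleftrightarrow> M = Mhat)"
proof (intro conjI allI impI)
  fix t M
  show "pt_prob Sig0 Sig1 q tau (msqrt Sig *v t) M =
          ncchi2_cdf TYPE('n) M
            ((norm ((msqrt (matrix_inv (matrix_inv Sig0 + matrix_inv Sig1)) ** matrix_inv Sig1 ** msqrt Sig) *v t)) ^ 2)
          * ncchi2_cdf TYPE('n) q
            ((norm ((matrix_inv (msqrt (Sig0 + Sig1)) ** msqrt Sig) *v t)) ^ 2)
          + (LINT u:{u. q < (norm u) ^ 2}|lborel.
              ncchi2_cdf TYPE('n) M
                ((norm ((msqrt (matrix_inv (matrix_inv Sig0 + matrix_inv Sig1)) ** matrix_inv Sig1) *v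
                        (msqrt Sig *v t - msqrt (Sig0 + Sig1) *v u))) ^ 2)
              * gauss_density ((matrix_inv (msqrt (Sig0 + Sig1)) ** msqrt Sig) *v t) (mat 1) u)"
    using pt_prob_formula[OF assms(1,2), of q tau "msqrt Sig *v t" M]
    by (simp only: matrix_vector_mul_assoc)
next
  let ?K = "{Delta. \<forall>j. \<bar>(matrix_inv (msqrt Sig) *v Delta) $ j\<bar> \<le> b $ j}"
  \<comment> \<open>Zero bias is admissible since b is nonnegative. Thus the infimum runs over a
    nonempty set.\<close>
  have "0 \<in> ?K" using assms(4) by simp
  then have "?K \<noteq> {}" by blast
  then show "let F = (\<lambda>M. INF Delta\<in>?K. pt_prob Sig0 Sig1 q tau Delta M);
          Mhat = Inf {M. 0 \<le> M \<and> 1 - zeta \<le> F M}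
      in \<forall>M. F M = 1 - zeta \<longleftrightarrow> M = Mhat"
    unfolding Let_def using assms
    by (intro allI INF_pt_prob_quantile bounded_matrix_inv_box spd_mat_msqrt) auto
qed

end
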